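(* Let $\mathcal{H}$ be a real reproducing kernel Hilbert space on some domain $\Omega$. Let $\psi$ be a continuous function on $\Omega$. Let $K\subseteq\Omega$ be compact. Then there exists a measure supported on the green frontier $\mathrm{Green}(K)$ of $K$ which embeds to $\mathrm{topiary}(K)$.
   Context: A real reproducing kernel Hilbert space $\mathcal{H}$ on a domain $\Omega$ is a Hilbert space of real-valued functions on $\Omega$ such that point evaluation at each $\alpha\in\Omega$ is a bounded linear functional; $k_\alpha\in\mathcal{H}$ denotes the element with $f(\alpha)=\langle f,k_\alpha\rangle$ for all $f\in\mathcal{H}$. A distribution is a compactly supported probability measure on $\Omega$. To a distribution $\mu$ one associates, via the Riesz representation theorem applied to the functional given by integration against $\mu$, the embedded distribution in $\mathcal{H}$, also denoted $\mu$, so that $\int f\,d\mu=\langle f,\mu\rangle$ for $f\in\mathcal{H}$. The map taking a measure to its corresponding element of $\mathcal{H}$ is the kernel embedding of distributions; a measure embeds to an element of $\mathcal{H}$ if that element is its image under this map. The space of embedded measures on $K$ is the weak closure of the image under the kernel embedding of the distributions on $K$. Norms of distributions are norms of their embeddings in $\mathcal{H}$, and $\mu(x)=\langle\mu,k_x\rangle$. The topiary of $K$ with respect to $\psi$ over $\mathcal{H}$, denoted $\mathrm{topiary}(K)$, is the maximizer of $\mathfrak{O}(\mu)=\int\psi\,d\mu-\|\mu\|^2/2$ over all distributions on $K$; it may not be unique as a measure, but the embedded measure is unique, and $\mathrm{topiary}(K)$ here denotes that element of $\mathcal{H}$. The aesthetic margin of $\mu$ is the function $\iota_\mu=\psi-\mu-\int(\psi(t)-\mu(t))\,d\mu(t)$.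 Let $\mathcal{U}$ be the collection of all open dense subsets of the space of embedded measures on $K$. For $U\in\mathcal{U}$ let $$M_U=\{x\in K:\iota_\mu(x)=\sup_K\iota_\mu\text{ for some }\mu\in U\}.$$ (The last term of $\iota_\mu$ is a constant, so the points of $K$ at which $\iota_\mu$ attains its supremum over $K$ are those at which $\psi-\mu$ does.) The green frontier of $K$ is $\mathrm{Green}(K)=\bigcap_{U\in\mathcal{U}}\overline{M_U}$.
   Formalization: Assumes all functions in H are continuous on Ω and K is nonempty; without continuity topiary(K) may not exist (H = ℓ²([0,1]), ψ(x) = x, K = [0,1]). Ω is Hausdorff, and open dense subsets of the space of embedded measures are taken in the norm topology. *)

theory Defs
  imports "HOL-Probability.Probability_Measure"
begin

text \<open>
  A real Hilbert space of functions on \<open>\<Omega>\<close> is given by a complete inner product space \<open>'h\<close> together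
  with the map \<open>ev\<close> sending an element of \<open>'h\<close> to the function it is. Only the values on \<open>\<Omega>\<close>
  matter, so \<open>ev\<close> has to be injective there; linearity of the evaluations says that the vector
  space operations of \<open>'h\<close> are the pointwise ones. In this notation \<open>\<langle>m, k\<^sub>x\<rangle>\<close> is \<open>ev m x\<close>.
\<close>

definition rkhs :: "'a set \<Rightarrow> ('h::{real_inner,complete_space} \<Rightarrow> 'a \<Rightarrow> real) \<Rightarrow> bool" where
  "rkhs \<Omega> ev \<longleftrightarrow>
     (\<forall>\<alpha>\<in>\<Omega>. bounded_linear (\<lambda>f. ev f \<alpha>)) \<and>
     (\<forall>f g. (\<forall>\<alpha>\<in>\<Omega>. ev f \<alpha> = ev g \<alpha>) \<longrightarrow> f = g)"

text \<open>
  Borel probability measures on the subspace \<open>\<Omega>\<close> that are concentrated on \<open>K\<close>. The definition is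
  meant for compact \<open>K \<subseteq> \<Omega>\<close>, where these are the distributions on \<open>K\<close>.
\<close>

definition distributions :: "'a::topological_space set \<Rightarrow> 'a set \<Rightarrow> 'a measure set" where
  "distributions \<Omega> K =
     {\<mu>. prob_space \<mu> \<and> sets \<mu> = sets (restrict_space borel \<Omega>) \<and> emeasure \<mu> K = 1}"

definition kernel_embedding :: "('h::real_inner \<Rightarrow> 'a \<Rightarrow> real) \<Rightarrow> 'a measure \<Rightarrow> 'h" where
  "kernel_embedding ev \<mu> = (THE m. \<forall>f. (\<integral>x. ev f x \<partial>\<mu>) = f \<bullet> m)"

text \<open>By Riesz representation, the inner products exhaust the continuous linear functionals.\<close>

definition weak_topology :: "'h::real_inner topology" where
  "weak_topology = topology_generated_by {{x. x \<bullet> h \<in> W} | h W. open W}"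

definition embedded_measures ::
    "'a::topological_space set \<Rightarrow> ('h::real_inner \<Rightarrow> 'a \<Rightarrow> real) \<Rightarrow> 'a set \<Rightarrow> 'h set" where
  "embedded_measures \<Omega> ev K =
     weak_topology closure_of (kernel_embedding ev ` distributions \<Omega> K)"

definition objective :: "('h::real_inner \<Rightarrow> 'a \<Rightarrow> real) \<Rightarrow> ('a \<Rightarrow> real) \<Rightarrow> 'a measure \<Rightarrow> real" where
  "objective ev \<psi> \<mu> = (\<integral>x. \<psi> x \<partial>\<mu>) - (norm (kernel_embedding ev \<mu>))\<^sup>2 / 2"

text \<open>The maximizing measure need not be unique, but its embedding is.\<close>

definition topiary ::
    "'a::topological_space set \<Rightarrow> ('h::real_inner \<Rightarrow> 'a \<Rightarrow> real) \<Rightarrow> ('a \<Rightarrow> real) \<Rightarrow> 'a set \<Rightarrow> 'h" where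
  "topiary \<Omega> ev \<psi> K =
     (THE m. \<exists>\<mu>\<in>distributions \<Omega> K.
        (\<forall>\<nu>\<in>distributions \<Omega> K. objective ev \<psi> \<nu> \<le> objective ev \<psi> \<mu>) \<and>
        kernel_embedding ev \<mu> = m)"

text \<open>
  The aesthetic margin of \<open>\<mu>\<close> is \<open>\<psi> - \<mu>\<close> minus the constant \<open>\<integral> (\<psi> - \<mu>) d\<mu>\<close>. That constant depends on
  the measure and not only on the embedded element \<open>m\<close>, and it plays no role for where the
  supremum over \<open>K\<close> is attained, so it is left out.
\<close>

definition margin_maximizers ::
    "('h \<Rightarrow> 'a \<Rightarrow> real) \<Rightarrow> ('a \<Rightarrow> real) \<Rightarrow> 'a set \<Rightarrow> 'h set \<Rightarrow> 'a set" where
  "margin_maximizers ev \<psi> K U =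
     {x\<in>K. \<exists>m\<in>U. \<psi> x - ev m x = (SUP y\<in>K. \<psi> y - ev m y)}"

text \<open>
  Open and dense refer to the norm topology. If the reproducing kernel is jointly continuous, the
  embedded measures on a compact set form a norm compact set, on which the norm topology and the
  weak topology agree.
\<close>

definition green_frontier ::
    "'a::topological_space set \<Rightarrow> ('h::real_inner \<Rightarrow> 'a \<Rightarrow> real) \<Rightarrow> ('a \<Rightarrow> real) \<Rightarrow> 'a set \<Rightarrow> 'a set" where
  "green_frontier \<Omega> ev \<psi> K =
     (\<Inter>U\<in>{U. openin (top_of_set (embedded_measures \<Omega> ev K)) U \<and>
             embedded_measures \<Omega> ev K \<subseteq> closure U}.
        closure (margin_maximizers ev \<psi> K U))"

end

theory Submission
  imports Defs "HOL-Probability.Probability_Mass_Function"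
begin

text \<open>
  A distribution \<open>\<mu>\<close> with embedding \<open>m\<close> maximises the objective on \<open>K\<close> iff \<open>\<psi> - m \<le> \<integral> (\<psi> - m) d\<mu>\<close> on \<open>K\<close>, and
  the embedding of a maximiser is unique. Let \<open>U\<close> be open and dense, and let \<open>\<mu>\<close> be a maximiser on the
  compact set \<open>L\<close>, the closure of \<open>M\<^sub>U\<close>. If the condition failed at a point of \<open>K\<close>, then for every element
  \<open>m'\<close> close to \<open>m\<close> the maxima of \<open>\<psi> - m'\<close> over \<open>K\<close> would lie outside \<open>L\<close>, although \<open>U\<close> contains such \<open>m'\<close>.
  So every \<open>L\<close> carries a measure that embeds to the topiary of \<open>K\<close>. The sets \<open>L\<close> are directed downwards,
  and a cluster point of these measures is supported on their intersection, the green frontier.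
\<close>

subsection \<open>Measures from contents on compact sets\<close>

text \<open>Since \<open>C\<close> lies in \<open>U \<union> V\<close>, the compact sets
  \<open>C - U\<close> and \<open>C - V\<close> are disjoint and have disjoint open neighbourhoods;
  cutting these out of \<open>C\<close> leaves the two pieces. Subadditivity of a content on open
  sets rests on this.\<close>

lemma compact_Un_split:
  fixes C :: "'a::t2_space set"
  assumes "compact C" "open U" "open V" "C \<subseteq> U \<union> V"
  obtains A B where "compact A" "compact B" "A \<subseteq> U" "B \<subseteq> V" "C = A \<union> B"
proof -
  have "\<exists>S T. open S \<and> open T \<and> x \<in> S \<and> y \<in> T \<and> S \<inter> T = {}" if "x \<noteq> y" for x y :: 'a
    using hausdorff[OF that] .
  then have "Hausdorff_space (euclidean :: 'a topology)"
    by (simp add: Hausdorff_space_def disjnt_def)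
  moreover have "compactin euclidean (C - U)" "compactin euclidean (C - V)" "disjnt (C - U) (C - V)"
    using assms by (auto simp: compact_diff disjnt_def)
  ultimately obtain S T where ST: "open S" "open T" "C - U \<subseteq> S" "C - V \<subseteq> T" "disjnt S T"
    using Hausdorff_space_compact_separation[of "euclidean :: 'a topology" "C - U" "C - V"]
    by (metis open_openin)
  show ?thesis
  proof (rule that[of "C - S" "C - T"])
    show "compact (C - S)" "compact (C - T)"
      using assms ST by (auto simp: compact_diff)
    show "C - S \<subseteq> U" "C - T \<subseteq> V" using ST by auto
    show "C = C - S \<union> (C - T)" using ST by (auto simp: disjnt_def)
  qed
qed

text \<open>The content is extended to open sets by inner approximation, and from there to an outer measure.
  On a compact set the resulting measure may exceed \<open>P\<close>.\<close>

lemma measure_of_compact_content: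
  fixes P :: "'a::t2_space set \<Rightarrow> ennreal"
  assumes empty: "P {} = 0"
    and mono: "\<And>C D. compact C \<Longrightarrow> compact D \<Longrightarrow> C \<subseteq> D \<Longrightarrow> P C \<le> P D"
    and subadd: "\<And>C D. compact C \<Longrightarrow> compact D \<Longrightarrow> P (C \<union> D) \<le> P C + P D"
    and add: "\<And>C D. compact C \<Longrightarrow> compact D \<Longrightarrow> C \<inter> D = {} \<Longrightarrow> P (C \<union> D) = P C + P D"
  obtains M where "sets M = sets borel"
    "\<And>V. open V \<Longrightarrow> emeasure M V = (SUP C\<in>{C. compact C \<and> C \<subseteq> V}. P C)"
proof -
  define l where "l V = (SUP C\<in>{C. compact C \<and> C \<subseteq> V}. P C)" for V
  define m where "m A = (INF V\<in>{V. open V \<and> A \<subseteq> V}. l V)" for A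
  have P_le: "P C \<le> l V" if "compact C" "C \<subseteq> V" for C V
    unfolding l_def using that by (intro SUP_upper) auto
  have l_mono: "l V \<le> l W" if "V \<subseteq> W" for V W
    unfolding l_def using that by (intro SUP_subset_mono) auto
  have m_le: "m A \<le> l V" if "open V" "A \<subseteq> V" for A V
    unfolding m_def using that by (intro INF_lower) auto
  have m_open: "m V = l V" if "open V" for V
  proof (rule antisym)
    show "l V \<le> m V" unfolding m_def by (rule INF_greatest) (auto intro: l_mono)
  qed (use that m_le in auto)
  have l_empty: "l {} = 0"
    by (simp add: l_def empty conj_commute cong: conj_cong)
  have m_empty: "m {} = 0" using m_open[of "{}"] l_empty by simp
  have m_mono: "m A \<le> m B" if "A \<subseteq> B" for A B
    unfolding m_def using that by (intro INF_superset_mono) auto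
  have l_Un: "l (U \<union> V) \<le> l U + l V" if UV: "open U" "open V" for U V
    unfolding l_def[of "U \<union> V"]
  proof (rule SUP_least, clarify)
    fix C assume "compact C" "C \<subseteq> U \<union> V"
    then obtain A B where "compact A" "compact B" "A \<subseteq> U" "B \<subseteq> V" "C = A \<union> B"
      using compact_Un_split UV by metis
    then show "P C \<le> l U + l V"
      using subadd[of A B] P_le[of A U] P_le[of B V] by (meson add_mono order_trans)
  qed
  have l_UN: "l (\<Union>i<n. U i) \<le> (\<Sum>i<n. l (U i))" if "\<And>i. open (U i)" for U and n :: nat
  proof (induction n)
    case (Suc n)
    have "l (\<Union>i<Suc n. U i) \<le> l (\<Union>i<n. U i) + l (U n)"
      using l_Un[of "\<Union>i<n. U i" "U n"] that by (auto simp: lessThan_Suc Un_commute)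
    then show ?case using Suc by (simp add: add_mono order_trans[OF _ add_right_mono])
  qed (simp add: l_empty)
  \<comment> \<open>A compact subset of the countable union already lies in a finite partial union,
    which reduces the claim to \<open>l_UN\<close>.\<close>
  have l_UN': "l (\<Union>i. U i) \<le> (\<Sum>i. l (U i))" if op: "\<And>i. open (U i)" for U :: "nat \<Rightarrow> 'a set"
    unfolding l_def[of "\<Union>i. U i"]
  proof (rule SUP_least, clarify)
    fix C assume C: "compact C" "C \<subseteq> (\<Union>i. U i)"
    obtain I where I: "finite I" "C \<subseteq> (\<Union>i\<in>I. U i)"
      using compactE_image[OF C(1), of UNIV U] C(2) op by metis
    obtain n where "I \<subseteq> {..<n}" using I(1) finite_nat_iff_bounded by auto
    then have "P C \<le> l (\<Union>i<n. U i)" using I C by (intro P_le) blast+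
    also have "\<dots> \<le> (\<Sum>i<n. l (U i))" using l_UN op by blast
    also have "\<dots> \<le> (\<Sum>i. l (U i))" by (rule sum_le_suminf) auto
    finally show "P C \<le> (\<Sum>i. l (U i))" .
  qed
  have m_UN: "m (\<Union>i. A i) \<le> (\<Sum>i. m (A i))" for A :: "nat \<Rightarrow> 'a set"
  proof (rule ennreal_le_epsilon)
    fix e :: real assume fin: "(\<Sum>i. m (A i)) < top" and e: "0 < e"
    \<comment> \<open>Finiteness of the sum makes every \<open>m (A i)\<close> finite, so
      near-optimal open covers exist; the allowances \<open>e * (1/2)^Suc i\<close> add up to
      \<open>e\<close>.\<close>
    have "\<exists>V. open V \<and> A i \<subseteq> V \<and> l V \<le> m (A i) + ennreal (e * (1/2)^Suc i)" for i
    proof -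
      have "m (A i) < top" using fin
        by (metis ennreal_suminf_lessD)
      then have "m (A i) < m (A i) + ennreal (e * (1/2)^Suc i)"
        using e by (simp add: ennreal_zero_less_mult_iff)
      then show ?thesis unfolding m_def[of "A i"] INF_less_iff
        by (auto intro: less_imp_le)
    qed
    then obtain V where V: "\<And>i. open (V i)" "\<And>i. A i \<subseteq> V i"
      "\<And>i. l (V i) \<le> m (A i) + ennreal (e * (1/2)^Suc i)" by metis
    have "m (\<Union>i. A i) \<le> l (\<Union>i. V i)" using V by (intro m_le) auto
    also have "\<dots> \<le> (\<Sum>i. l (V i))" using l_UN' V by blast
    also have "\<dots> \<le> (\<Sum>i. m (A i) + ennreal (e * (1/2)^Suc i))" using V by (intro suminf_le) auto
    also have "\<dots> = (\<Sum>i. m (A i)) + (\<Sum>i. ennreal (e * (1/2)^Suc i))" by (rule suminf_add[symmetric]) auto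
    also have "(\<Sum>i. ennreal (e * (1/2)^Suc i)) = ennreal e"
      using sums_mult[OF power_half_series, of e] e
      by (intro suminf_ennreal_eq) auto
    finally show "m (\<Union>i. A i) \<le> (\<Sum>i. m (A i)) + ennreal e" .
  qed
  interpret sigma_algebra "UNIV :: 'a set" "Pow UNIV" by (rule sigma_algebra_Pow)
  have oms: "outer_measure_space (Pow UNIV) m"
    unfolding outer_measure_space_def positive_def increasing_def countably_subadditive_def
    using m_empty m_mono m_UN by auto
  define L where "L = lambda_system UNIV (Pow UNIV) m"
  have ms: "measure_space UNIV L m" unfolding L_def by (rule caratheodory_lemma[OF oms])
  \<comment> \<open>Caratheodory's condition for open \<open>U\<close>: exhaust
    \<open>V \<inter> U\<close> from inside by compact \<open>C\<close>, then the open set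
    \<open>V - C\<close>, which contains \<open>A - U\<close>, by compact \<open>D\<close>. On the
    disjoint sets \<open>C\<close> and \<open>D\<close> the content adds up, and their union stays
    in \<open>V\<close>.\<close>
  have open_L: "U \<in> L" if U: "open U" for U
  proof -
    have key: "m (A \<inter> U) + m (A - U) \<le> l V" if V: "open V" "A \<subseteq> V" for A V
    proof -
      have *: "P C + m (A - U) \<le> l V" if C: "compact C" "C \<subseteq> V \<inter> U" for C
      proof -
        have op: "open (V - C)" using V C by (simp add: compact_imp_closed open_Diff)
        have "P C + m (A - U) \<le> P C + l (V - C)"
          using V C op by (intro add_left_mono m_le) auto
        also have "\<dots> = (SUP D\<in>{D. compact D \<and> D \<subseteq> V - C}. P C + P D)"
          unfolding l_def by (subst ennreal_SUP_add_right[symmetric]) auto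
        also have "\<dots> \<le> l V"
        proof (rule SUP_least, clarify)
          fix D assume D: "compact D" "D \<subseteq> V - C"
          then have "P C + P D = P (C \<union> D)" using C by (subst add) auto
          also have "\<dots> \<le> l V" using C D by (intro P_le) auto
          finally show "P C + P D \<le> l V" .
        qed
        finally show ?thesis .
      qed
      have "m (A \<inter> U) + m (A - U) \<le> l (V \<inter> U) + m (A - U)"
        using V U by (intro add_right_mono m_le) auto
      also have "\<dots> = (SUP C\<in>{C. compact C \<and> C \<subseteq> V \<inter> U}. P C + m (A - U))"
        unfolding l_def by (subst ennreal_SUP_add_left[symmetric]) auto
      also have "\<dots> \<le> l V" using * by (intro SUP_least) auto
      finally show ?thesis .
    qed
    have "m (A \<inter> U) + m (A - U) = m A" for A
    proof (rule antisym)
      show "m (A \<inter> U) + m (A - U) \<le> m A"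
        unfolding m_def[of A] using key by (intro INF_greatest) auto
      have "m A = m (\<Union>i. binaryset (A \<inter> U) (A - U) i)"
        unfolding UN_binaryset_eq by (rule arg_cong[where f = m]) auto
      also have "\<dots> \<le> (\<Sum>i. m (binaryset (A \<inter> U) (A - U) i))" by (rule m_UN)
      also have "\<dots> = m (A \<inter> U) + m (A - U)" 
        by (rule suminf_binaryset_eq[of m, OF m_empty])
      finally show "m A \<le> m (A \<inter> U) + m (A - U)" .
    qed
    then show ?thesis unfolding L_def lambda_system_eq by auto
  qed
  have sa: "sigma_algebra UNIV L" using ms by (simp add: measure_space_def)
  have borel_L: "sets (borel :: 'a measure) \<subseteq> L"
    using sigma_algebra.sigma_sets_subset[OF sa, of "Collect open"] open_L
    by (auto simp: borel_def)
  define M where "M = measure_of UNIV (sets borel) m"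
  have sM: "sets M = sets borel" unfolding M_def
    using sets.sets_measure_of_eq[of borel m] by simp
  have "emeasure M V = m V" if "V \<in> sets borel" for V
  proof (rule emeasure_measure_of[OF M_def])
    show "countably_additive (sets M) m"
      using ms borel_L unfolding sM measure_space_def countably_additive_def by blast
    show "positive (sets M) m" by (simp add: positive_def m_empty)
  qed (use that sM in auto)
  then have "emeasure M V = l V" if "open V" for V
    using that m_open by auto
  then show ?thesis using that[of M] sM l_def by auto
qed

subsection \<open>Uniform boundedness and Riesz representation\<close>

text \<open>Baire category: the closed sets \<open>E n\<close> cover the space, so one of them
  contains a ball, and a uniform bound on a ball rescales to a bound on the operator norms.\<close>

lemma uniform_boundedness:
  fixes T :: "'i \<Rightarrow> 'h::{real_normed_vector,complete_space} \<Rightarrow> 'b::real_normed_vector"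
  assumes lin: "\<And>i. i \<in> I \<Longrightarrow> bounded_linear (T i)"
    and bdd: "\<And>f. bounded ((\<lambda>i. T i f) ` I)"
  obtains B where "0 < B" "\<And>i f. i \<in> I \<Longrightarrow> norm (T i f) \<le> B * norm f"
proof -
  define E where "E n = {f. \<forall>i\<in>I. norm (T i f) \<le> real n}" for n :: nat
  have cl: "closed (E n)" for n
  proof -
    have "E n = (\<Inter>i\<in>I. {f. norm (T i f) \<le> real n})" by (auto simp: E_def)
    also have "closed \<dots>"
      using lin by (intro closed_INT ballI closed_Collect_le continuous_intros)
        (auto intro: linear_continuous_on)
    finally show ?thesis .
  qed
  have "\<exists>n. interior (E n) \<noteq> {}"
  proof (rule ccontr)
    assume "\<not> ?thesis"
    then have "interior (\<Union>(range E)) = {}"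
      using Met_TC.metric_Baire_category_alt[where 'a = 'h and ?\<G> = "range E"] cl complete_UNIV
      by auto
    moreover have "\<Union>(range E) = UNIV"
    proof (intro equalityI subset_UNIV subsetI)
      fix f
      obtain b where "\<forall>i\<in>I. norm (T i f) \<le> b" using bdd[of f] by (auto simp: bounded_iff)
      moreover obtain n where "b \<le> real n" using real_arch_simple by blast
      ultimately have "f \<in> E n" by (force simp: E_def)
      then show "f \<in> \<Union>(range E)" by blast
    qed
    ultimately show False by simp
  qed
  then obtain n f0 where "f0 \<in> interior (E n)" by blast
  then obtain r where r: "0 < r" "ball f0 r \<subseteq> E n" by (meson mem_interior)
  \<comment> \<open>On differences of two points of the ball the bound is \<open>2 * n\<close>, and
    \<open>c\<close> below scales \<open>f\<close> to length \<open>r / 2\<close>, whence the factor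
    4. The added 1 keeps the constant positive when \<open>n = 0\<close>.\<close>
  show ?thesis
  proof (rule that[of "(4 * real n + 1) / r"])
    fix i f assume i: "i \<in> I"
    interpret bounded_linear "T i" using lin i .
    show "norm (T i f) \<le> (4 * real n + 1) / r * norm f"
    proof (cases "f = 0")
      case False
      define c where "c = r / (2 * norm f)"
      have c: "0 < c" using False r by (simp add: c_def)
      have "norm (c *\<^sub>R f) = r / 2" using r False by (simp add: c_def)
      then have "f0 + c *\<^sub>R f \<in> E n" "f0 \<in> E n"
        using r by (auto intro!: subsetD[OF r(2)] simp: dist_norm)
      then have "norm (T i (f0 + c *\<^sub>R f)) \<le> n" "norm (T i f0) \<le> n" using i by (auto simp: E_def)
      then have "norm (T i (f0 + c *\<^sub>R f) - T i f0) \<le> 2 * real n"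
        by (smt (verit) norm_triangle_ineq4)
      then have "c * norm (T i f) \<le> 2 * real n" using c by (simp add: add scaleR)
      then have "norm (T i f) \<le> 4 * real n / r * norm f" using c False r
        by (simp add: c_def field_simps)
      also have "\<dots> \<le> (4 * real n + 1) / r * norm f"
        using r by (intro mult_right_mono divide_right_mono) auto
      finally show ?thesis .
    qed simp
  qed (use r in auto)
qed

text \<open>First-order condition at an interior minimum. A nonzero \<open>a\<close> is refuted at
  \<open>t = - a / c\<close> with \<open>c > b\<close>, where the expression equals
  \<open>a^2 / c^2 * (b - c)\<close>.\<close>

lemma quadratic_nonneg_imp_linear_zero:
  fixes a b :: real
  assumes "\<And>t. 0 \<le> t * a + t\<^sup>2 * b"
  shows "a = 0"
proof (rule ccontr)
  assume "a \<noteq> 0"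
  define c where "c = \<bar>b\<bar> + 1"
  have c: "c > 0" "b - c < 0" by (auto simp: c_def)
  have "0 \<le> (- a / c) * a + (- a / c)\<^sup>2 * b" by (rule assms)
  also have "\<dots> = a\<^sup>2 / c\<^sup>2 * (b - c)"
    using c by (simp add: field_simps power2_eq_square)
  also have "\<dots> < 0" using c \<open>a \<noteq> 0\<close> by (intro mult_pos_neg) auto
  finally show False by simp
qed

text \<open>The representing vector minimises \<open>\<lambda>f. \<parallel>f\<parallel>\<^sup>2 / 2 - L f\<close>; the parallelogram law makes minimising
  sequences Cauchy.\<close>

lemma riesz_representation:
  fixes L :: "'h::{real_inner,complete_space} \<Rightarrow> real"
  assumes "bounded_linear L"
  obtains m where "\<And>f. L f = f \<bullet> m"
proof -
  interpret bounded_linear L by fact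
  define \<phi> where "\<phi> f = (norm f)\<^sup>2 / 2 - L f" for f
  obtain B where B: "\<And>f. norm (L f) \<le> norm f * B" using bounded by blast
  have "- B\<^sup>2 / 2 \<le> \<phi> f" for f
  proof -
    have "L f \<le> norm f * B" using B[of f] by simp
    moreover have "0 \<le> (norm f - B)\<^sup>2" by simp
    ultimately show ?thesis by (simp add: \<phi>_def power2_diff)
  qed
  then have bb: "bdd_below (range \<phi>)" by (rule bdd_belowI2)
  define s where "s = (INF f. \<phi> f)"
  have s_le: "s \<le> \<phi> f" for f unfolding s_def using bb by (intro cINF_lower) auto
  have "\<exists>f. \<phi> f < s + 1 / Suc n" for n
    using cINF_less_iff[OF _ bb, of "s + 1 / Suc n"] by (auto simp: s_def)
  then obtain x where x: "\<And>n. \<phi> (x n) < s + 1 / Suc n" by metis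
  have par: "(norm (f - g))\<^sup>2 = 4 * (\<phi> f + \<phi> g - 2 * \<phi> ((1/2) *\<^sub>R (f + g)))" for f g
    unfolding \<phi>_def scaleR add
    by (simp add: power2_norm_eq_inner inner_commute algebra_simps
        power2_eq_square[of 2] add_divide_distrib)
  have d: "(norm (x m - x n))\<^sup>2 < 4 / Suc m + 4 / Suc n" for m n
  proof -
    have "4 / real (Suc m) = 4 * (1 / Suc m)" "4 / real (Suc n) = 4 * (1 / Suc n)" by simp_all
    then show ?thesis
      unfolding par using x[of m] x[of n] s_le[of "(1/2) *\<^sub>R (x m + x n)"] by argo
  qed
  have "Cauchy x"
  proof (rule metric_CauchyI)
    fix e :: real assume e: "0 < e"
    obtain N where N: "8 / e\<^sup>2 < real N" using reals_Archimedean2 by blast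
    have "dist (x m) (x n) < e" if "m \<ge> N" "n \<ge> N" for m n
    proof -
      have "8 / e\<^sup>2 < Suc m" "8 / e\<^sup>2 < Suc n" using that N by linarith+
      then have "4 / Suc m < e\<^sup>2 / 2" "4 / Suc n < e\<^sup>2 / 2" using e by (auto simp: field_simps)
      then have "(norm (x m - x n))\<^sup>2 < e\<^sup>2" using d[of m n] by linarith
      then show ?thesis unfolding dist_norm using e by (simp add: power2_less_imp_less)
    qed
    then show "\<exists>M. \<forall>m\<ge>M. \<forall>n\<ge>M. dist (x m) (x n) < e" by blast
  qed
  then obtain m where m: "x \<longlonglongrightarrow> m" using Cauchy_convergent convergent_def by blast
  have "(\<lambda>n. \<phi> (x n)) \<longlonglongrightarrow> \<phi> m"
    unfolding \<phi>_def by (intro tendsto_intros m tendsto) simp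
  moreover have "(\<lambda>n. s + 1 / Suc n) \<longlonglongrightarrow> s + 0"
    by (intro tendsto_intros LIMSEQ_inverse_real_of_nat[unfolded inverse_eq_divide])
  ultimately have "\<phi> m \<le> s + 0"
    using x by (intro LIMSEQ_le[of "\<lambda>n. \<phi> (x n)" _ "\<lambda>n. s + 1 / Suc n"]) (auto intro: less_imp_le)
  then have min: "\<phi> m \<le> \<phi> f" for f using s_le[of f] by linarith
  have "L f = f \<bullet> m" for f
  proof -
    have "0 \<le> t * (f \<bullet> m - L f) + t\<^sup>2 * ((norm f)\<^sup>2 / 2)" for t
    proof -
      have "\<phi> (m + t *\<^sub>R f) - \<phi> m = t * (f \<bullet> m - L f) + t\<^sup>2 * ((norm f)\<^sup>2 / 2)"
        unfolding \<phi>_def add scaleR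
        by (simp add: power2_norm_eq_inner inner_add inner_commute algebra_simps power2_eq_square[of t])
      then show ?thesis using min[of "m + t *\<^sub>R f"] by linarith
    qed
    then show ?thesis using quadratic_nonneg_imp_linear_zero by fastforce
  qed
  then show ?thesis by (rule that)
qed

subsection \<open>Distributions on compact sets\<close>

lemma distributionsD:
  assumes "\<nu> \<in> distributions \<Omega> K"
  shows "prob_space \<nu>" "sets \<nu> = sets (restrict_space borel \<Omega>)" "space \<nu> = \<Omega>" "emeasure \<nu> K = 1"
  using assms sets_eq_imp_space_eq[of \<nu> "restrict_space borel \<Omega>"]
  by (auto simp: distributions_def space_restrict_space)

lemma distributions_closed_sets:
  assumes "\<nu> \<in> distributions \<Omega> K" "closed C" "C \<subseteq> \<Omega>"
  shows "C \<in> sets \<nu>"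
proof -
  have "C = \<Omega> \<inter> C" "C \<in> sets borel" using assms by auto
  then show ?thesis unfolding distributionsD(2)[OF assms(1)] sets_restrict_space by blast
qed

lemma distributions_AE:
  assumes "\<nu> \<in> distributions \<Omega> K"
  shows "AE x in \<nu>. x \<in> K"
proof -
  interpret prob_space \<nu> using distributionsD[OF assms] by auto
  \<comment> \<open>\<open>emeasure\<close> is 0 outside the sigma-algebra, so the value 1 forces
    \<open>K\<close> to be measurable.\<close>
  have "emeasure \<nu> K \<noteq> 0" using distributionsD(4)[OF assms] by simp
  then have "K \<in> sets \<nu>" by (rule emeasure_neq_0_sets)
  moreover have "prob K = 1" using distributionsD(4)[OF assms] by (simp add: measure_def)
  ultimately show ?thesis by (auto simp: prob_eq_1)
qed

lemma distributions_measurable: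
  fixes f :: "'a::topological_space \<Rightarrow> real"
  assumes "\<nu> \<in> distributions \<Omega> K" "continuous_on \<Omega> f"
  shows "f \<in> borel_measurable \<nu>"
  using borel_measurable_continuous_on_restrict[OF assms(2)]
    measurable_cong_sets[OF distributionsD(2)[OF assms(1)] refl] by blast

lemma distributions_integrable:
  fixes f :: "'a::topological_space \<Rightarrow> real"
  assumes \<nu>: "\<nu> \<in> distributions \<Omega> K" and "compact K" "K \<subseteq> \<Omega>" and f: "continuous_on \<Omega> f"
  shows "integrable \<nu> f"
proof -
  interpret prob_space \<nu> using distributionsD[OF \<nu>] by auto
  have "compact (f ` K)" using assms by (meson compact_continuous_image continuous_on_subset)
  then have "bounded (f ` K)" by (rule compact_imp_bounded)
  then obtain B where "\<forall>x\<in>K. norm (f x) \<le> B" unfolding bounded_iff by blast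
  then have "AE x in \<nu>. norm (f x) \<le> B" using distributions_AE[OF \<nu>] by auto
  then show ?thesis using distributions_measurable[OF \<nu> f] by (rule integrable_const_bound)
qed

lemma distributions_integral_mono:
  fixes f g :: "'a::topological_space \<Rightarrow> real"
  assumes \<nu>: "\<nu> \<in> distributions \<Omega> K" and "compact K" "K \<subseteq> \<Omega>"
    and "continuous_on \<Omega> f" "continuous_on \<Omega> g" "\<And>x. x \<in> K \<Longrightarrow> f x \<le> g x"
  shows "(\<integral>x. f x \<partial>\<nu>) \<le> (\<integral>x. g x \<partial>\<nu>)"
proof (rule integral_mono_AE)
  show "AE x in \<nu>. f x \<le> g x" using distributions_AE[OF \<nu>] assms by auto
qed (use assms distributions_integrable in blast)+

lemma distributions_mono:
  assumes "\<nu> \<in> distributions \<Omega> L" "L \<subseteq> K" "closed K" "K \<subseteq> \<Omega>"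
  shows "\<nu> \<in> distributions \<Omega> K"
proof -
  interpret prob_space \<nu> using distributionsD[OF assms(1)] by auto
  have "emeasure \<nu> L \<le> emeasure \<nu> K"
    using distributions_closed_sets[OF assms(1)] assms by (intro emeasure_mono) auto
  then have "1 \<le> emeasure \<nu> K" using distributionsD(4)[OF assms(1)] by simp
  then have "emeasure \<nu> K = 1" by (intro antisym emeasure_le_1)
  then show ?thesis using assms(1) by (simp add: distributions_def)
qed

section \<open>Layer-cake bounds and convergence of integrals\<close>

text \<open>The sum counts the positive integers up to \<open>y\<close>, hence equals the floor of
  \<open>y\<close>; the bound \<open>y \<le> n\<close> ensures that none is cut off.\<close>

lemma layer_bounds:
  fixes y :: real
  assumes "0 \<le> y" "y \<le> real n"
  shows "(\<Sum>k=1..n. of_bool (real k \<le> y)) \<le> y" "y \<le> 1 + (\<Sum>k=1..n. of_bool (real k \<le> y))"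
proof -
  have "{k\<in>{1..n}. real k \<le> y} = {1..nat \<lfloor>y\<rfloor>}"
  proof -
    have iff: "real k \<le> y \<longleftrightarrow> k \<le> nat \<lfloor>y\<rfloor>" for k :: nat
      using assms(1) by (simp add: le_nat_iff le_floor_iff)
    have "nat \<lfloor>y\<rfloor> \<le> n" using assms by linarith
    then have "{k\<in>{1..n}. k \<le> nat \<lfloor>y\<rfloor>} = {1..nat \<lfloor>y\<rfloor>}" by auto
    then show ?thesis unfolding iff .
  qed
  then have "(\<Sum>k=1..n. of_bool (real k \<le> y)) = real (nat \<lfloor>y\<rfloor>)"
    by (simp add: of_bool_def sum.If_cases Int_def)
  then show "(\<Sum>k=1..n. of_bool (real k \<le> y)) \<le> y" "y \<le> 1 + (\<Sum>k=1..n. of_bool (real k \<le> y))"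
    using assms by linarith+
qed

text \<open>\<open>layer_bounds\<close> at \<open>n * f x\<close>, divided by \<open>n\<close> and
  integrated. The integral of \<open>f\<close> is pinned down to within \<open>1 / n\<close> by the
  measures of finitely many compact sets, which is all that a content on compact sets can
  see.\<close>

lemma distributions_layer_bounds:
  fixes f :: "'a::t2_space \<Rightarrow> real" and n :: nat
  assumes \<nu>: "\<nu> \<in> distributions \<Omega> K" and K: "compact K" "K \<subseteq> \<Omega>"
    and f: "continuous_on \<Omega> f" "\<And>x. x \<in> K \<Longrightarrow> 0 \<le> f x" "\<And>x. x \<in> K \<Longrightarrow> f x \<le> 1" and n: "0 < n"
  defines "C \<equiv> \<lambda>k. {x\<in>K. real k / real n \<le> f x}"
  shows "(\<Sum>k=1..n. measure \<nu> (C k)) / n \<le> (\<integral>x. f x \<partial>\<nu>)"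
    and "(\<integral>x. f x \<partial>\<nu>) \<le> 1 / n + (\<Sum>k=1..n. measure \<nu> (C k)) / n"
    and "\<And>k. compact (C k)"
proof -
  interpret prob_space \<nu> using distributionsD[OF \<nu>] by auto
  have fK: "continuous_on K f" using f(1) K(2) by (rule continuous_on_subset)
  show C: "compact (C k)" for k
  proof -
    have "C k = K \<inter> (f -` {real k / real n..} \<inter> K)" by (auto simp: C_def)
    moreover have "closed (f -` {real k / real n..} \<inter> K)"
      using fK K by (intro continuous_on_closed_vimage[THEN iffD1, rule_format])
        (auto simp: compact_imp_closed)
    ultimately show ?thesis using K(1) by (metis compact_Int_closed)
  qed
  have Cs: "C k \<in> sets \<nu>" for k
  proof (rule distributions_closed_sets[OF \<nu>])
    show "closed (C k)" using C by (rule compact_imp_closed)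
  qed (use K in \<open>auto simp: C_def\<close>)
  have int: "integrable \<nu> f" by (rule distributions_integrable[OF \<nu> K f(1)])
  have sumint: "integrable \<nu> (\<lambda>x. (\<Sum>k=1..n. indicator (C k) x) / n :: real)"
    using Cs by (intro integrable_divide integrable_sum) (auto simp: emeasure_eq_measure)
  have sumeq: "(\<integral>x. (\<Sum>k=1..n. indicator (C k) x) / n \<partial>\<nu>) = (\<Sum>k=1..n. measure \<nu> (C k)) / n"
    using Cs by (subst integral_divide_zero, subst Bochner_Integration.integral_sum)
      (auto simp: emeasure_eq_measure)
  have pt: "(\<Sum>k=1..n. indicator (C k) x) / n \<le> f x"
      "f x \<le> 1 / n + (\<Sum>k=1..n. indicator (C k) x) / n" if "x \<in> K" for x
  proof -
    have "0 \<le> n * f x" "n * f x \<le> n" using f that n by (auto simp: mult_left_le)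
    note * = layer_bounds[OF this]
    have eq: "(\<Sum>k=1..n. indicator (C k) x) = (\<Sum>k=1..n. of_bool (real k \<le> n * f x) :: real)"
      using that n by (intro sum.cong) (auto simp: C_def field_simps indicator_def)
    show "(\<Sum>k=1..n. indicator (C k) x) / n \<le> f x"
      "f x \<le> 1 / n + (\<Sum>k=1..n. indicator (C k) x) / n"
      using *[folded eq] n by (simp_all add: field_simps del: sum_of_bool_eq)
  qed
  have "(\<integral>x. (\<Sum>k=1..n. indicator (C k) x) / n \<partial>\<nu>) \<le> (\<integral>x. f x \<partial>\<nu>)"
    using distributions_AE[OF \<nu>] pt by (intro integral_mono_AE sumint int) auto
  then show "(\<Sum>k=1..n. measure \<nu> (C k)) / n \<le> (\<integral>x. f x \<partial>\<nu>)" unfolding sumeq .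
  have "integrable \<nu> (\<lambda>x. 1 / n + (\<Sum>k=1..n. indicator (C k) x) / n)"
    by (intro Bochner_Integration.integrable_add sumint) simp
  then have "(\<integral>x. f x \<partial>\<nu>) \<le> (\<integral>x. 1 / n + (\<Sum>k=1..n. indicator (C k) x) / n \<partial>\<nu>)"
    using distributions_AE[OF \<nu>] pt by (intro integral_mono_AE int) auto
  also have "\<dots> = 1 / n + (\<Sum>k=1..n. measure \<nu> (C k)) / n"
    using sumint sumeq by (subst Bochner_Integration.integral_add) (auto simp: prob_space)
  finally show "(\<integral>x. f x \<partial>\<nu>) \<le> 1 / n + (\<Sum>k=1..n. measure \<nu> (C k)) / n" .
qed

text \<open>The upper layer sum of \<open>\<nu>\<close> tends to that of \<open>P\<close>. As
  \<open>\<mu>\<close> dominates \<open>P\<close> on compact sets, the latter exceeds the lower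
  layer sum of \<open>\<mu>\<close> by at most \<open>1 / n\<close>.\<close>

lemma portmanteau_upper:
  fixes f :: "'a::t2_space \<Rightarrow> real"
  assumes ev: "eventually (\<lambda>\<nu>. \<nu> \<in> distributions \<Omega> K) G" and \<mu>: "\<mu> \<in> distributions \<Omega> K"
    and K: "compact K" "K \<subseteq> \<Omega>"
    and P: "\<And>C. compact C \<Longrightarrow> C \<subseteq> K \<Longrightarrow> ((\<lambda>\<nu>. measure \<nu> C) \<longlongrightarrow> P C) G"
    and le: "\<And>C. compact C \<Longrightarrow> C \<subseteq> K \<Longrightarrow> P C \<le> measure \<mu> C"
    and f: "continuous_on \<Omega> f" "\<And>x. x \<in> K \<Longrightarrow> 0 \<le> f x" "\<And>x. x \<in> K \<Longrightarrow> f x \<le> 1" and e: "0 < e"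
  shows "eventually (\<lambda>\<nu>. (\<integral>x. f x \<partial>\<nu>) < (\<integral>x. f x \<partial>\<mu>) + e) G"
proof -
  obtain n where n: "0 < n" "1 / real n < e" using e nat_approx_posE[OF e] by (metis zero_less_Suc)
  define C where "C k = {x\<in>K. real k / real n \<le> f x}" for k
  note lb = distributions_layer_bounds[OF _ K f n(1), folded C_def]
  have CK: "C k \<subseteq> K" for k by (auto simp: C_def)
  have "((\<lambda>\<nu>. 1 / n + (\<Sum>k=1..n. measure \<nu> (C k)) / n) \<longlongrightarrow> 1 / n + (\<Sum>k=1..n. P (C k)) / n) G"
    using lb(3)[OF \<mu>] CK by (intro tendsto_intros P) (use n in auto)
  moreover have "1 / n + (\<Sum>k=1..n. P (C k)) / n < (\<integral>x. f x \<partial>\<mu>) + e"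
  proof -
    have "(\<Sum>k=1..n. P (C k)) / n \<le> (\<Sum>k=1..n. measure \<mu> (C k)) / n"
      using lb(3)[OF \<mu>] CK by (intro divide_right_mono sum_mono le) auto
    also have "\<dots> \<le> (\<integral>x. f x \<partial>\<mu>)" by (rule lb(1)[OF \<mu>])
    finally show ?thesis using n by linarith
  qed
  ultimately have "eventually (\<lambda>\<nu>. 1 / n + (\<Sum>k=1..n. measure \<nu> (C k)) / n < (\<integral>x. f x \<partial>\<mu>) + e) G"
    by (rule order_tendstoD)
  then show ?thesis using ev by eventually_elim (use lb(2) in fastforce)
qed

text \<open>The upper bound for both \<open>f\<close> and \<open>- f\<close>, each moved affinely
  into the unit interval, yields the limit.\<close>

lemma tendsto_integral:
  fixes f :: "'a::t2_space \<Rightarrow> real"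
  assumes ev: "eventually (\<lambda>\<nu>. \<nu> \<in> distributions \<Omega> K) G" and \<mu>: "\<mu> \<in> distributions \<Omega> K"
    and K: "compact K" "K \<subseteq> \<Omega>"
    and P: "\<And>C. compact C \<Longrightarrow> C \<subseteq> K \<Longrightarrow> ((\<lambda>\<nu>. measure \<nu> C) \<longlongrightarrow> P C) G"
    and le: "\<And>C. compact C \<Longrightarrow> C \<subseteq> K \<Longrightarrow> P C \<le> measure \<mu> C"
    and f: "continuous_on \<Omega> f"
  shows "((\<lambda>\<nu>. \<integral>x. f x \<partial>\<nu>) \<longlongrightarrow> (\<integral>x. f x \<partial>\<mu>)) G"
proof (rule tendstoI)
  fix e :: real assume e: "0 < e"
  have "compact (f ` K)" using f K by (meson compact_continuous_image continuous_on_subset)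
  then have "bounded (f ` K)" by (rule compact_imp_bounded)
  then obtain B where B: "0 < B" "\<And>x. x \<in> K \<Longrightarrow> \<bar>f x\<bar> \<le> B"
    unfolding bounded_pos by auto
  have aff: "(\<integral>x. (c * f x + B) / (2 * B) \<partial>\<nu>) = (c * (\<integral>x. f x \<partial>\<nu>) + B) / (2 * B)"
    if "\<nu> \<in> distributions \<Omega> K" for \<nu> c
  proof -
    interpret prob_space \<nu> using distributionsD[OF that] by auto
    show ?thesis using distributions_integrable[OF that K f] by (simp add: prob_space)
  qed
  have up: "eventually (\<lambda>\<nu>. (\<integral>x. (c * f x + B) / (2 * B) \<partial>\<nu>) < (\<integral>x. (c * f x + B) / (2 * B) \<partial>\<mu>) + e / (2 * B)) G"
    if c: "c \<in> {1, - 1}" for c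
  proof (rule portmanteau_upper[OF ev \<mu> K P le])
    show "continuous_on \<Omega> (\<lambda>x. (c * f x + B) / (2 * B))"
      using B by (intro continuous_intros f) auto
    show "0 < e / (2 * B)" using e B by simp
    show "0 \<le> (c * f x + B) / (2 * B)" "(c * f x + B) / (2 * B) \<le> 1" if "x \<in> K" for x
      using B(2)[OF that] B(1) c by (auto simp: field_simps abs_le_iff)
  qed
  from up[OF insertI1] up[OF insertI2[OF insertI1]] ev
  show "eventually (\<lambda>\<nu>. dist (\<integral>x. f x \<partial>\<nu>) (\<integral>x. f x \<partial>\<mu>) < e) G"
  proof (eventually_elim)
    case (elim \<nu>)
    define a where "a = (\<integral>x. f x \<partial>\<nu>)"
    define b where "b = (\<integral>x. f x \<partial>\<mu>)"
    have "(1 * a + B) / (2 * B) < (1 * b + B) / (2 * B) + e / (2 * B)"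
      "(- 1 * a + B) / (2 * B) < (- 1 * b + B) / (2 * B) + e / (2 * B)"
      using elim(1,2) unfolding aff[OF elim(3)] aff[OF \<mu>] a_def b_def .
    then have "a < b + e" "b < a + e"
      unfolding add_divide_distrib[symmetric] using B(1) by (simp_all add: divide_less_cancel algebra_simps)
    then have "dist a b < e" by (simp add: dist_real_def abs_less_iff)
    then show ?case unfolding a_def b_def .
  qed
qed

section \<open>Cluster points of families of distributions\<close>

text \<open>Tychonoff: the points \<open>T \<nu>\<close> eventually lie in a compact cube, so their
  image filter has a cluster point \<open>P\<close>; \<open>G\<close> refines \<open>F\<close> by
  the preimages of the neighbourhoods of \<open>P\<close>.\<close>

lemma pointwise_cluster:
  fixes T :: "'b \<Rightarrow> 'c \<Rightarrow> real"
  assumes F: "F \<noteq> bot" and T: "eventually (\<lambda>\<nu>. \<forall>c. T \<nu> c \<in> {0..1}) F"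
  obtains G P where "G \<le> F" "G \<noteq> bot" "\<And>c. ((\<lambda>\<nu>. T \<nu> c) \<longlongrightarrow> P c) G"
proof -
  have "compactin (product_topology (\<lambda>_. euclidean) UNIV) (PiE UNIV (\<lambda>_::'c. {0..1::real}))"
    by (simp add: compactin_PiE)
  then have "compact (PiE UNIV (\<lambda>_::'c. {0..1::real}))"
    by (simp add: euclidean_product_topology)
  moreover have "filtermap T F \<noteq> bot" using F by (simp add: filtermap_bot_iff)
  moreover have "eventually (\<lambda>x. x \<in> PiE UNIV (\<lambda>_::'c. {0..1::real})) (filtermap T F)"
    using T by (auto simp: eventually_filtermap PiE_iff elim: eventually_mono)
  ultimately obtain P where P: "inf (nhds P) (filtermap T F) \<noteq> bot"
    unfolding compact_filter by blast
  define G where "G = inf F (filtercomap T (nhds P))"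
  have "G \<noteq> bot"
  proof
    assume "G = bot"
    then have "eventually (\<lambda>_. False) G" by simp
    then obtain Q R where Q: "eventually Q F" and R: "eventually R (nhds P)"
      and QR: "\<And>\<nu>. Q \<nu> \<Longrightarrow> R (T \<nu>) \<Longrightarrow> False"
      unfolding G_def eventually_inf eventually_filtercomap by metis
    have "eventually (\<lambda>x. \<not> R x) (filtermap T F)"
      unfolding eventually_filtermap using Q by eventually_elim (use QR in blast)
    with R have "eventually (\<lambda>_. False) (inf (nhds P) (filtermap T F))"
      unfolding eventually_inf by blast
    with P show False by (simp add: trivial_limit_def)
  qed
  moreover have "G \<le> F" unfolding G_def by simp
  moreover have "((\<lambda>\<nu>. T \<nu> c) \<longlongrightarrow> P c) G" for c
  proof -
    have "(T \<longlongrightarrow> P) (filtercomap T (nhds P))" by (rule filterlim_filtercomap)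
    then have "(T \<longlongrightarrow> P) G" by (rule tendsto_mono[rotated]) (simp add: G_def)
    show ?thesis
    proof (rule topological_tendstoI)
      fix S :: "real set" assume "open S" "P c \<in> S"
      moreover from this have "open {x. x c \<in> S}"
        using open_vimage[OF _ continuous_on_product_coordinates[of c]] by (simp add: vimage_def)
      ultimately show "eventually (\<lambda>\<nu>. T \<nu> c \<in> S) G"
        using topological_tendstoD[OF \<open>(T \<longlongrightarrow> P) G\<close>, of "{x. x c \<in> S}"] by simp
    qed
  qed
  ultimately show ?thesis using that by blast
qed

text \<open>This stands in for weak-star compactness of the regular Borel probability measures on \<open>K\<close>. The
  cluster point is taken in the product of the unit intervals over all sets, which yields only a content
  on compact sets; the measure built from it dominates the content there, and by the portmanteau
  inequality this is enough for the integrals of continuous functions to converge.\<close>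

lemma distributions_cluster:
  fixes K :: "'a::t2_space set"
  assumes K: "compact K" "K \<subseteq> \<Omega>" and F: "F \<noteq> bot"
    and D: "eventually (\<lambda>\<nu>. \<nu> \<in> distributions \<Omega> K) F"
  obtains G \<mu> where "G \<le> F" "G \<noteq> bot" "\<mu> \<in> distributions \<Omega> K"
    "\<And>f :: 'a \<Rightarrow> real. continuous_on \<Omega> f \<Longrightarrow> ((\<lambda>\<nu>. \<integral>x. f x \<partial>\<nu>) \<longlongrightarrow> (\<integral>x. f x \<partial>\<mu>)) G"
    "\<And>S. \<lbrakk>closed S; S \<subseteq> K; \<And>C. compact C \<Longrightarrow> C \<subseteq> K - S \<Longrightarrow>
       eventually (\<lambda>\<nu>. measure \<nu> C = 0) F\<rbrakk> \<Longrightarrow> \<mu> \<in> distributions \<Omega> S"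
proof -
  have clK: "closed K" using K by (rule_tac compact_imp_closed)
  \<comment> \<open>\<open>measure\<close> is total, so the cluster point can be indexed by
    arbitrary sets \<open>C\<close>. Intersecting with \<open>K\<close> puts every compact
    \<open>C\<close> into the sigma-algebra of \<open>\<nu>\<close>, which lives on
    \<open>\<Omega>\<close>.\<close>
  have "eventually (\<lambda>\<nu>. \<forall>C. measure \<nu> (C \<inter> K) \<in> {0..1}) F"
    using D by eventually_elim (auto dest!: distributionsD(1) intro: prob_space.prob_le_1)
  then obtain G P where G: "G \<le> F" "G \<noteq> bot"
    and P: "\<And>C. ((\<lambda>\<nu>. measure \<nu> (C \<inter> K)) \<longlongrightarrow> P C) G"
    by (rule pointwise_cluster[OF F]) blast
  have DG: "eventually (\<lambda>\<nu>. \<nu> \<in> distributions \<Omega> K) G" using D G(1) by (simp add: filter_leD)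
  have sets: "C \<inter> K \<in> sets \<nu>" if "\<nu> \<in> distributions \<Omega> K" "compact C" for C \<nu>
    using that K clK by (intro distributions_closed_sets[OF that(1)]) (auto simp: compact_imp_closed closed_Int)
  have P_nonneg: "0 \<le> P C" for C
    by (rule tendsto_lowerbound[OF P _ G(2)]) auto
  have P_empty: "P {} = 0"
    using tendsto_unique[OF G(2) P[of "{}"], of 0] by simp
  have P_mono: "P C \<le> P C'" if "compact C" "compact C'" "C \<subseteq> C'" for C C'
  proof (rule tendsto_le[OF G(2) P P], use DG in eventually_elim)
    case (elim \<nu>)
    then interpret prob_space \<nu> using distributionsD by blast
    show ?case using that sets[OF elim] by (intro finite_measure_mono) auto
  qed
  have P_subadd: "P (C \<union> C') \<le> P C + P C'" if "compact C" "compact C'" for C C'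
  proof (rule tendsto_le[OF G(2) tendsto_add[OF P P] P], use DG in eventually_elim)
    case (elim \<nu>)
    then show ?case using measure_Un_le[OF sets sets, OF elim that(1) elim that(2)]
      by (simp add: Int_Un_distrib2)
  qed
  have P_add: "P (C \<union> C') = P C + P C'" if "compact C" "compact C'" "C \<inter> C' = {}" for C C'
  proof (rule tendsto_unique[OF G(2) P])
    have "eventually (\<lambda>\<nu>. measure \<nu> (C \<inter> K) + measure \<nu> (C' \<inter> K) = measure \<nu> ((C \<union> C') \<inter> K)) G"
      using DG
    proof eventually_elim
      case (elim \<nu>)
      then interpret prob_space \<nu> using distributionsD by blast
      show ?case using that
        by (subst finite_measure_Union[symmetric]) (auto intro!: sets elim arg_cong[where f = prob])
    qed
    then show "((\<lambda>\<nu>. measure \<nu> ((C \<union> C') \<inter> K)) \<longlongrightarrow> P C + P C') G"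
      using tendsto_add[OF P P] by (rule Lim_transform_eventually[rotated])
  qed
  have P_1: "P C = 1" if "K \<subseteq> C" for C
  proof (rule tendsto_unique[OF G(2) P])
    have "eventually (\<lambda>\<nu>. 1 = measure \<nu> (C \<inter> K)) G"
      using DG
    proof eventually_elim
      case (elim \<nu>)
      then show ?case using distributionsD(4)[OF elim] that by (simp add: Int_absorb1 measure_def)
    qed
    then show "((\<lambda>\<nu>. measure \<nu> (C \<inter> K)) \<longlongrightarrow> 1) G"
      using tendsto_const by (rule Lim_transform_eventually[rotated])
  qed
  have P_0: "P C = 0" if "eventually (\<lambda>\<nu>. measure \<nu> (C \<inter> K) = 0) G" for C
    using tendsto_unique[OF G(2) P tendsto_eventually[OF that]] .
  obtain M where M: "sets M = sets borel"
    and MV: "\<And>V. open V \<Longrightarrow> emeasure M V = (SUP C\<in>{C. compact C \<and> C \<subseteq> V}. ennreal (P C))"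
    by (rule measure_of_compact_content[of "\<lambda>C. ennreal (P C)"])
      (auto simp: P_empty P_add P_nonneg ennreal_plus[symmetric] ennreal_leI P_mono P_subadd
        simp del: ennreal_plus)
  have spM: "space M = UNIV" using sets_eq_imp_space_eq[OF M] by simp
  have P_le_1: "P C \<le> 1" if "compact C" for C
    using P_mono[OF that, of "C \<union> K"] P_1[of "C \<union> K"] K that by (simp add: compact_Un)
  have "emeasure M (space M) = 1"
    unfolding spM MV[OF open_UNIV]
  proof (rule antisym)
    show "(SUP C\<in>{C. compact C \<and> C \<subseteq> UNIV}. ennreal (P C)) \<le> 1"
      using P_le_1 by (intro SUP_least) auto
    show "1 \<le> (SUP C\<in>{C. compact C \<and> C \<subseteq> UNIV}. ennreal (P C))"
      using K P_1[of K] by (intro SUP_upper2[of K]) auto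
  qed
  then interpret M: prob_space M by (rule prob_spaceI)
  have M_open: "measure M V \<le> c" if "open V" "0 \<le> c" "\<And>C. compact C \<Longrightarrow> C \<subseteq> V \<Longrightarrow> P C \<le> c" for V c
  proof -
    have "emeasure M V \<le> ennreal c"
      unfolding MV[OF that(1)] using that by (intro SUP_least) (auto intro: ennreal_leI)
    then show ?thesis using that(2) by (simp add: M.emeasure_eq_measure)
  qed
  have Mclosed: "measure M S = 1 - measure M (- S)" if "closed S" for S
    using M.prob_compl[of S] that M spM by (simp add: Compl_eq_Diff_UNIV)
  have support: "measure M S = 1" if "closed S" "\<And>C. compact C \<Longrightarrow> C \<inter> S = {} \<Longrightarrow> P C = 0" for S
    using Mclosed[OF that(1)] M_open[of "- S" 0] that
    by (auto simp: open_Compl disjoint_eq_subset_Compl intro: antisym)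
  have MK: "measure M K = 1"
  proof (rule support[OF clK], rule P_0)
    fix C assume "C \<inter> K = {}"
    then show "eventually (\<lambda>\<nu>. measure \<nu> (C \<inter> K) = 0) G" by simp
  qed
  \<comment> \<open>A compact \<open>D\<close> in the open set \<open>- C\<close> is disjoint from
    \<open>C\<close>, so additivity and total mass 1 give \<open>P D \<le> 1 - P C\<close>; the
    supremum over \<open>D\<close> bounds the measure of the complement.\<close>
  have P_le_M: "P C \<le> measure M C" if C: "compact C" for C
  proof -
    have "measure M (- C) \<le> 1 - P C"
    proof (rule M_open)
      fix D assume D: "compact D" "D \<subseteq> - C"
      then have "C \<inter> D = {}" by blast
      then show "P D \<le> 1 - P C"
        using P_add[OF C D(1)] P_le_1[OF compact_Un[OF C D(1)]] by simp
    qed (use C P_le_1 in \<open>auto simp: compact_imp_closed open_Compl\<close>)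
    then show ?thesis using Mclosed[OF compact_imp_closed[OF C]] by linarith
  qed
  \<comment> \<open>\<open>M\<close> lives on the whole type, a distribution on the subspace
    \<open>\<Omega>\<close>. The transfer goes through \<open>K\<close>, which is Borel and carries
    all of \<open>M\<close>, while \<open>\<Omega>\<close> may fail to be Borel.\<close>
  define \<mu> where "\<mu> = distr (restrict_space M K) (restrict_space borel \<Omega>) (\<lambda>x. x)"
  have KM: "K \<in> sets M" using M clK by simp
  have meas: "(\<lambda>x. x) \<in> measurable (restrict_space M K) (restrict_space borel \<Omega>)"
  proof (rule measurable_restrict_space2)
    show "(\<lambda>x. x) \<in> measurable (restrict_space M K) borel"
      using M by (intro measurable_restrict_space1 measurable_ident_sets)
    show "(\<lambda>x. x) \<in> space (restrict_space M K) \<rightarrow> \<Omega>" using K by (auto simp: space_restrict_space)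
  qed
  have em: "emeasure \<mu> S = emeasure M S" if S: "closed S" "S \<subseteq> K" for S
  proof -
    have "S = \<Omega> \<inter> S" "S \<in> sets borel" using S K by auto
    then have "S \<in> sets (restrict_space borel \<Omega>)" unfolding sets_restrict_space by blast
    then have "emeasure \<mu> S = emeasure (restrict_space M K) (S \<inter> K)"
      unfolding \<mu>_def by (subst emeasure_distr[OF meas]) (auto simp: space_restrict_space spM)
    also have "\<dots> = emeasure M S"
      using S KM spM by (subst emeasure_restrict_space) (auto simp: Int_absorb2)
    finally show ?thesis .
  qed
  have "prob_space \<mu>"
    unfolding \<mu>_def
  proof (rule prob_space.prob_space_distr[OF _ meas], rule prob_spaceI)
    show "emeasure (restrict_space M K) (space (restrict_space M K)) = 1"
      using KM spM MK by (simp add: space_restrict_space emeasure_restrict_space M.emeasure_eq_measure)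
  qed
  then have \<mu>: "\<mu> \<in> distributions \<Omega> S" if "closed S" "S \<subseteq> K" "measure M S = 1" for S
    using em[OF that(1,2)] that(3) by (simp add: distributions_def M.emeasure_eq_measure) (simp add: \<mu>_def)
  show ?thesis
  proof (rule that[OF G])
    show \<mu>K: "\<mu> \<in> distributions \<Omega> K" using \<mu>[OF clK _ MK] by simp
    show "((\<lambda>\<nu>. \<integral>x. f x \<partial>\<nu>) \<longlongrightarrow> (\<integral>x. f x \<partial>\<mu>)) G" if "continuous_on \<Omega> f" for f :: "'a \<Rightarrow> real"
    proof (rule tendsto_integral[OF DG \<mu>K K _ _ that])
      fix C assume C: "compact C" "C \<subseteq> K"
      show "((\<lambda>\<nu>. measure \<nu> C) \<longlongrightarrow> P C) G" using P[of C] C by (simp add: Int_absorb2)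
      show "P C \<le> measure \<mu> C"
        using P_le_M[OF C(1)] em[of C] C by (simp add: measure_def compact_imp_closed)
    qed
    fix S assume S: "closed S" "S \<subseteq> K"
      and 0: "\<And>C. compact C \<Longrightarrow> C \<subseteq> K - S \<Longrightarrow> eventually (\<lambda>\<nu>. measure \<nu> C = 0) F"
    show "\<mu> \<in> distributions \<Omega> S"
    proof (rule \<mu>[OF S support[OF S(1) P_0]])
      fix C assume "compact C" "C \<inter> S = {}"
      then have "eventually (\<lambda>\<nu>. measure \<nu> (C \<inter> K) = 0) F"
        using clK by (intro 0) (auto simp: compact_Int_closed)
      then show "eventually (\<lambda>\<nu>. measure \<nu> (C \<inter> K) = 0) G" using G(1) by (rule filter_leD[rotated])
    qed
  qed
qed

section \<open>Dirac measures and mixtures\<close>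

lemma distributions_return:
  assumes "x \<in> K" "closed K" "K \<subseteq> \<Omega>"
  shows "return (restrict_space borel \<Omega>) x \<in> distributions \<Omega> K"
proof -
  have x: "x \<in> space (restrict_space borel \<Omega>)" using assms by (auto simp: space_restrict_space)
  have "K = \<Omega> \<inter> K" "K \<in> sets borel" using assms by auto
  then have "K \<in> sets (restrict_space borel \<Omega>)" unfolding sets_restrict_space by blast
  then show ?thesis using prob_space_return[OF x] assms(1) by (simp add: distributions_def)
qed

text \<open>Convexity of the set of distributions, used to move a maximiser towards a competitor.
  The mixture is the law of a sample from \<open>\<mu>\<close> or \<open>\<nu>\<close>, chosen by a
  Bernoulli variable with parameter \<open>t\<close>.\<close>

lemma distributions_mixture:
  fixes K :: "'a::t2_space set"
  assumes \<mu>: "\<mu> \<in> distributions \<Omega> K" and \<nu>: "\<nu> \<in> distributions \<Omega> K"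
    and K: "compact K" "K \<subseteq> \<Omega>" and t: "0 \<le> t" "t \<le> 1"
  obtains \<kappa> where "\<kappa> \<in> distributions \<Omega> K"
    "\<And>f :: 'a \<Rightarrow> real. continuous_on \<Omega> f \<Longrightarrow>
       (\<integral>x. f x \<partial>\<kappa>) = t * (\<integral>x. f x \<partial>\<mu>) + (1 - t) * (\<integral>x. f x \<partial>\<nu>)"
proof -
  define N where "N = restrict_space borel \<Omega>"
  define k where "k b = (if b then \<mu> else \<nu>)" for b
  define p where "p = measure_pmf (bernoulli_pmf t)"
  define \<kappa> where "\<kappa> = p \<bind> k"
  have kD: "k b \<in> distributions \<Omega> K" for b using \<mu> \<nu> by (simp add: k_def)
  note k = distributionsD[OF kD, folded N_def]
  have km: "k \<in> measurable p (subprob_algebra N)"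
    using k(1,2) by (auto simp: p_def space_subprob_algebra prob_space_imp_subprob_space)
  interpret p: prob_space p unfolding p_def by (rule prob_space_measure_pmf)
  have "K = \<Omega> \<inter> K" "K \<in> sets borel" using K by (auto simp: compact_imp_closed)
  then have KN: "K \<in> sets N" unfolding N_def sets_restrict_space by blast
  have "prob_space \<kappa>"
    unfolding \<kappa>_def using k(1) km by (intro p.prob_space_bind) auto
  moreover have "sets \<kappa> = sets N" unfolding \<kappa>_def using k(2) by (simp add: p_def)
  moreover have "emeasure \<kappa> K = 1"
    unfolding \<kappa>_def using km KN k(4) p.emeasure_space_1
    by (subst emeasure_bind) (auto simp: p_def)
  ultimately have \<kappa>: "\<kappa> \<in> distributions \<Omega> K" by (simp add: distributions_def N_def)
  show ?thesis
  proof (rule that[OF \<kappa>])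
    fix f :: "'a \<Rightarrow> real" assume f: "continuous_on \<Omega> f"
    \<comment> \<open>Truncation to \<open>K\<close> changes no integral against a distribution on
      \<open>K\<close> and makes the integrand bounded everywhere, as \<open>integral_join\<close>
      demands.\<close>
    define g where "g x = f x * indicator K x" for x
    have "compact (f ` K)" using f K by (meson compact_continuous_image continuous_on_subset)
    then have "bounded (f ` K)" by (rule compact_imp_bounded)
    then obtain B where B: "0 < B" "\<And>x. x \<in> K \<Longrightarrow> \<bar>f x\<bar> \<le> B"
      unfolding bounded_pos by auto
    have gN: "g \<in> borel_measurable N"
      unfolding g_def using borel_measurable_continuous_on_restrict[OF f] KN
      by (intro borel_measurable_times borel_measurable_indicator) (auto simp: N_def)
    have fg: "(\<integral>x. f x \<partial>\<rho>) = (\<integral>x. g x \<partial>\<rho>)" if "\<rho> \<in> distributions \<Omega> K" for \<rho>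
    proof (rule integral_cong_AE)
      show "AE x in \<rho>. f x = g x" using distributions_AE[OF that] by (auto simp: g_def)
      show "f \<in> borel_measurable \<rho>" using distributions_measurable[OF that f] .
      show "g \<in> borel_measurable \<rho>"
        using gN measurable_cong_sets[OF distributionsD(2)[OF that, folded N_def] refl] by blast
    qed
    have "(\<integral>x. g x \<partial>\<kappa>) = (\<integral>\<rho>. (\<integral>x. g x \<partial>\<rho>) \<partial>(distr p (subprob_algebra N) k))"
      unfolding \<kappa>_def bind_nonempty''[OF km p.not_empty]
    proof (rule integral_join[OF gN])
      show "\<bar>g x\<bar> \<le> B" for x using B by (auto simp: g_def indicator_def)
      show "finite_measure (distr p (subprob_algebra N) k)"
        using p.prob_space_distr[OF km] by (simp add: prob_space.finite_measure)
      show "AE \<rho> in distr p (subprob_algebra N) k. emeasure \<rho> (space \<rho>) \<le> ennreal 1"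
        by (rule AE_I2) (auto simp: space_subprob_algebra intro: subprob_space.subprob_emeasure_le_1)
    qed simp
    also have "\<dots> = (\<integral>b. (\<integral>x. g x \<partial>k b) \<partial>p)"
      by (rule integral_distr[OF km]) (use integral_measurable_subprob_algebra[OF gN] in simp)
    also have "\<dots> = t * (\<integral>x. g x \<partial>\<mu>) + (1 - t) * (\<integral>x. g x \<partial>\<nu>)"
      using t by (simp add: p_def k_def)
    finally show "(\<integral>x. f x \<partial>\<kappa>) = t * (\<integral>x. f x \<partial>\<mu>) + (1 - t) * (\<integral>x. f x \<partial>\<nu>)"
      unfolding fg[OF \<kappa>] fg[OF \<mu>] fg[OF \<nu>] .
  qed
qed

subsection \<open>The topiary and the green frontier\<close>

text \<open>First-order condition at the left end of an interval. A positive \<open>a\<close> is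
  refuted at \<open>t = a / c\<close>, where \<open>c > a\<close> keeps \<open>t\<close> below 1 and
  \<open>c > b\<close> makes the inequality fail.\<close>

lemma tangent_nonpos:
  fixes a b :: real
  assumes "\<And>t. 0 \<le> t \<Longrightarrow> t \<le> 1 \<Longrightarrow> t * a \<le> t\<^sup>2 * b"
  shows "a \<le> 0"
proof (rule ccontr)
  assume "\<not> a \<le> 0"
  define c where "c = max a b + 1"
  have c: "0 < a" "a < c" "b < c" using \<open>\<not> a \<le> 0\<close> by (auto simp: c_def)
  have "a / c * a \<le> (a / c)\<^sup>2 * b" using c by (intro assms) auto
  also have "\<dots> < (a / c)\<^sup>2 * c" using c by (intro mult_strict_left_mono) auto
  also have "\<dots> = a / c * a" using c by (simp add: power2_eq_square)
  finally show False by simp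
qed

section \<open>Embeddings of distributions on a compact set\<close>

text \<open>\<open>K\<close> is a parameter because the theory is used twice: for the given compact
  set and, through \<open>compact_rkhs_subset\<close>, for the closure of a set of margin
  maximisers.\<close>

locale compact_rkhs =
  fixes \<Omega> :: "'a::t2_space set"
    and ev :: "'h::{real_inner,complete_space} \<Rightarrow> 'a \<Rightarrow> real"
    and \<psi> :: "'a \<Rightarrow> real"
    and K :: "'a set"
  assumes rkhs: "rkhs \<Omega> ev"
    and cont_ev: "\<And>f. continuous_on \<Omega> (ev f)"
    and cont_psi: "continuous_on \<Omega> \<psi>"
    and compact_K: "compact K" and K_subset: "K \<subseteq> \<Omega>" and K_nonempty: "K \<noteq> {}"
begin

abbreviation D where "D \<equiv> distributions \<Omega> K"
abbreviation emb where "emb \<equiv> kernel_embedding ev"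
abbreviation obj where "obj \<equiv> objective ev \<psi>"

definition maximizer :: "'a measure \<Rightarrow> bool" where
  "maximizer \<mu> \<longleftrightarrow> \<mu> \<in> D \<and> (\<forall>\<nu>\<in>D. obj \<nu> \<le> obj \<mu>)"

lemma closed_K: "closed K"
  using compact_K by (rule compact_imp_closed)

lemma bounded_linear_ev: "x \<in> \<Omega> \<Longrightarrow> bounded_linear (\<lambda>f. ev f x)"
  using rkhs by (simp add: rkhs_def)

lemma ev_linear:
  assumes "x \<in> \<Omega>"
  shows "ev (f + g) x = ev f x + ev g x" "ev (f - g) x = ev f x - ev g x"
    "ev (c *\<^sub>R f) x = c * ev f x"
proof -
  interpret bounded_linear "\<lambda>f. ev f x" using bounded_linear_ev[OF assms] .
  show "ev (f + g) x = ev f x + ev g x" "ev (f - g) x = ev f x - ev g x"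
    "ev (c *\<^sub>R f) x = c * ev f x"
    by (simp_all add: add diff scaleR)
qed

text \<open>Each \<open>ev f\<close> is continuous, hence bounded on the compact set
  \<open>K\<close>, so uniform boundedness applies to the evaluations. In terms of kernels, the
  norms of \<open>k\<^sub>x\<close> are bounded over \<open>K\<close>.\<close>

lemma ev_bound:
  obtains B where "0 < B" "\<And>f x. x \<in> K \<Longrightarrow> \<bar>ev f x\<bar> \<le> B * norm f"
proof -
  have "bounded ((\<lambda>x. ev f x) ` K)" for f
    using compact_continuous_image[OF continuous_on_subset[OF cont_ev K_subset] compact_K]
    by (simp add: compact_imp_bounded)
  then obtain B where "0 < B" "\<And>x f. x \<in> K \<Longrightarrow> norm (ev f x) \<le> B * norm f"
    using uniform_boundedness[of K "\<lambda>x f. ev f x"] bounded_linear_ev K_subset by blast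
  then show ?thesis using that by simp
qed

lemma integrable_D:
  fixes f :: "'a \<Rightarrow> real"
  shows "\<mu> \<in> D \<Longrightarrow> continuous_on \<Omega> f \<Longrightarrow> integrable \<mu> f"
  using distributions_integrable compact_K K_subset by blast

lemma integral_D_mono:
  fixes f g :: "'a \<Rightarrow> real"
  shows "\<lbrakk>\<mu> \<in> D; continuous_on \<Omega> f; continuous_on \<Omega> g; \<And>x. x \<in> K \<Longrightarrow> f x \<le> g x\<rbrakk>
    \<Longrightarrow> (\<integral>x. f x \<partial>\<mu>) \<le> (\<integral>x. g x \<partial>\<mu>)"
  using distributions_integral_mono compact_K K_subset by blast

lemma integral_const_D: "\<mu> \<in> D \<Longrightarrow> (\<integral>x. c \<partial>\<mu>) = (c :: real)"
  using prob_space.prob_space[OF distributionsD(1)] by fastforce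

lemma emb_eqI:
  assumes "\<And>f. (\<integral>x. ev f x \<partial>\<mu>) = f \<bullet> m"
  shows "emb \<mu> = m"
  unfolding kernel_embedding_def
proof (rule the_equality)
  fix m' assume "\<forall>f. (\<integral>x. ev f x \<partial>\<mu>) = f \<bullet> m'"
  then have "(m' - m) \<bullet> m' = (m' - m) \<bullet> m" using assms by simp
  then have "(m' - m) \<bullet> (m' - m) = 0" by (simp add: inner_diff_right)
  then show "m' = m" by simp
qed (use assms in simp)

text \<open>By \<open>ev_bound\<close>, integration against \<open>\<mu>\<close> is a bounded
  functional, so Riesz representation provides the vector that the \<open>THE\<close> in
  \<open>kernel_embedding\<close> asks for.\<close>

lemma integral_ev:
  assumes \<mu>: "\<mu> \<in> D"
  shows "(\<integral>x. ev f x \<partial>\<mu>) = f \<bullet> emb \<mu>"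
proof -
  obtain B where B: "0 < B" "\<And>f x. x \<in> K \<Longrightarrow> \<bar>ev f x\<bar> \<le> B * norm f" by (rule ev_bound) blast
  note int = integrable_D[OF \<mu> cont_ev]
  have sp: "space \<mu> = \<Omega>" using distributionsD(3)[OF \<mu>] .
  have "bounded_linear (\<lambda>f. \<integral>x. ev f x \<partial>\<mu>)"
  proof (rule bounded_linear_intro)
    show "(\<integral>x. ev (f + g) x \<partial>\<mu>) = (\<integral>x. ev f x \<partial>\<mu>) + (\<integral>x. ev g x \<partial>\<mu>)" for f g
      unfolding Bochner_Integration.integral_add[OF int int, symmetric]
      by (rule Bochner_Integration.integral_cong) (auto simp: sp ev_linear)
    show "(\<integral>x. ev (c *\<^sub>R f) x \<partial>\<mu>) = c *\<^sub>R (\<integral>x. ev f x \<partial>\<mu>)" for c f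
      unfolding integral_scaleR_right[symmetric]
      by (rule Bochner_Integration.integral_cong) (auto simp: sp ev_linear)
    fix f
    have "(\<integral>x. ev f x \<partial>\<mu>) \<le> (\<integral>x. B * norm f \<partial>\<mu>)"
      using B(2)[of _ f] by (intro integral_D_mono \<mu> cont_ev) (auto simp: abs_le_iff)
    moreover have "(\<integral>x. - (B * norm f) \<partial>\<mu>) \<le> (\<integral>x. ev f x \<partial>\<mu>)"
      using B(2)[of _ f] by (intro integral_D_mono \<mu> cont_ev) (force simp: abs_le_iff)+
    ultimately show "norm (\<integral>x. ev f x \<partial>\<mu>) \<le> norm f * B"
      unfolding integral_const_D[OF \<mu>] by (simp add: abs_le_iff mult.commute)
  qed
  then obtain m where m: "\<And>f. (\<integral>x. ev f x \<partial>\<mu>) = f \<bullet> m"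
    using riesz_representation by blast
  then show ?thesis using emb_eqI[OF m] by simp
qed

lemma D_return: "x \<in> K \<Longrightarrow> return (restrict_space borel \<Omega>) x \<in> D"
  using distributions_return closed_K K_subset by blast

lemma integral_dirac:
  fixes f :: "'a \<Rightarrow> real"
  assumes "x \<in> K" "continuous_on \<Omega> f"
  shows "(\<integral>y. f y \<partial>return (restrict_space borel \<Omega>) x) = f x"
  using assms K_subset
  by (intro integral_return borel_measurable_continuous_on_restrict)
    (auto simp: space_restrict_space)

section \<open>Maximisers of the objective\<close>

text \<open>The squared norm of \<open>m - emb \<nu>\<close> is nonnegative. The right-hand side is
  affine in \<open>\<nu>\<close> and equals \<open>obj \<nu>\<close> when
  \<open>m = emb \<nu>\<close>, so it is a tangent majorant of the concave objective.\<close>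

lemma obj_le:
  assumes "\<nu> \<in> D"
  shows "obj \<nu> \<le> (\<integral>x. \<psi> x \<partial>\<nu>) - m \<bullet> emb \<nu> + (norm m)\<^sup>2 / 2"
proof -
  have "0 \<le> (norm (m - emb \<nu>))\<^sup>2" by simp
  then show ?thesis unfolding objective_def
    by (simp add: power2_norm_eq_inner inner_diff inner_commute)
qed

lemma maximizer_exists: "\<exists>\<mu>. maximizer \<mu>"
proof -
  obtain x0 where x0: "x0 \<in> K" using K_nonempty by blast
  obtain z where z: "\<And>x. x \<in> K \<Longrightarrow> \<psi> x \<le> \<psi> z"
    using continuous_attains_sup[OF compact_K K_nonempty continuous_on_subset[OF cont_psi K_subset]] by blast
  have ub: "obj \<nu> \<le> \<psi> z" if "\<nu> \<in> D" for \<nu>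
  proof -
    have "(\<integral>x. \<psi> x \<partial>\<nu>) \<le> (\<integral>x. \<psi> z \<partial>\<nu>)" using z by (intro integral_D_mono that cont_psi) auto
    then show ?thesis using integral_const_D[OF that, of "\<psi> z"] unfolding objective_def
      by (smt (verit) divide_nonneg_nonneg zero_le_power2)
  qed
  then have bdd: "bdd_above (obj ` D)" by (rule bdd_aboveI2)
  have ne: "D \<noteq> {}" using D_return[OF x0] by blast
  define s where "s = (SUP \<nu>\<in>D. obj \<nu>)"
  have s: "obj \<nu> \<le> s" if "\<nu> \<in> D" for \<nu> unfolding s_def using bdd that by (rule cSUP_upper[rotated])
  have "\<exists>\<nu>\<in>D. s - 1 / Suc n < obj \<nu>" for n
    using less_cSUP_iff[OF ne bdd, of "s - 1 / Suc n"] by (simp add: s_def)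
  then obtain \<nu> where \<nu>: "\<And>n. \<nu> n \<in> D" "\<And>n. s - 1 / Suc n < obj (\<nu> n)" by metis
  have "eventually (\<lambda>\<nu>. \<nu> \<in> D) (filtermap \<nu> sequentially)"
    using \<nu> by (simp add: eventually_filtermap)
  then obtain G \<mu> where G: "G \<le> filtermap \<nu> sequentially" "G \<noteq> bot" and \<mu>: "\<mu> \<in> D"
    and lim: "\<And>f :: 'a \<Rightarrow> real. continuous_on \<Omega> f \<Longrightarrow> ((\<lambda>\<nu>. \<integral>x. f x \<partial>\<nu>) \<longlongrightarrow> (\<integral>x. f x \<partial>\<mu>)) G"
    by (rule distributions_cluster[OF compact_K K_subset, rotated]) (auto simp: filtermap_bot_iff)
  have DG: "eventually (\<lambda>\<nu>. \<nu> \<in> D) G"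
    using \<nu> G(1) by (auto simp: eventually_filtermap intro: filter_leD)
  \<comment> \<open>Convergence of integrals says nothing directly about norms of embeddings, so
    along the maximising sequence \<open>obj\<close> is compared with its tangent majorant at
    \<open>emb \<mu>\<close>. That majorant is built from integrals of fixed continuous functions
    and tends to \<open>obj \<mu>\<close>.\<close>
  have "s \<le> obj \<mu>"
  proof (rule tendsto_le[OF G(2)])
    let ?m = "emb \<mu>"
    have "((\<lambda>\<nu>. (\<integral>x. \<psi> x \<partial>\<nu>) - (\<integral>x. ev ?m x \<partial>\<nu>) + (norm ?m)\<^sup>2 / 2)
      \<longlongrightarrow> (\<integral>x. \<psi> x \<partial>\<mu>) - (\<integral>x. ev ?m x \<partial>\<mu>) + (norm ?m)\<^sup>2 / 2) G"
      by (intro tendsto_intros lim cont_psi cont_ev) simp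
    also have "(\<integral>x. \<psi> x \<partial>\<mu>) - (\<integral>x. ev ?m x \<partial>\<mu>) + (norm ?m)\<^sup>2 / 2 = obj \<mu>"
      unfolding integral_ev[OF \<mu>] objective_def by (simp add: power2_norm_eq_inner)
    finally show "((\<lambda>\<nu>. (\<integral>x. \<psi> x \<partial>\<nu>) - (\<integral>x. ev ?m x \<partial>\<nu>) + (norm ?m)\<^sup>2 / 2) \<longlongrightarrow> obj \<mu>) G" .
    have "(\<lambda>n. s - 1 / Suc n) \<longlonglongrightarrow> s - 0"
      by (intro tendsto_intros LIMSEQ_inverse_real_of_nat[unfolded inverse_eq_divide])
    then have "(\<lambda>n. s - 1 / Suc n) \<longlonglongrightarrow> s" by simp
    moreover have "eventually (\<lambda>n. s - 1 / Suc n \<le> obj (\<nu> n)) sequentially"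
      "eventually (\<lambda>n. obj (\<nu> n) \<le> s) sequentially"
      using \<nu> s by (auto intro!: always_eventually less_imp_le)
    ultimately have "(\<lambda>n. obj (\<nu> n)) \<longlonglongrightarrow> s"
      by (rule tendsto_sandwich[OF _ _ _ tendsto_const, rotated 2])
    then have "(obj \<longlongrightarrow> s) (filtermap \<nu> sequentially)" by (simp add: filterlim_filtermap)
    then show "(obj \<longlongrightarrow> s) G" using G(1) by (rule tendsto_mono[rotated])
    show "eventually (\<lambda>\<nu>. obj \<nu> \<le> (\<integral>x. \<psi> x \<partial>\<nu>) - (\<integral>x. ev ?m x \<partial>\<nu>) + (norm ?m)\<^sup>2 / 2) G"
      using DG by eventually_elim (simp add: integral_ev obj_le)
  qed
  then have "maximizer \<mu>" using \<mu> s by (fastforce simp: maximizer_def)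
  then show ?thesis ..
qed

text \<open>Along the mixtures with weight \<open>t\<close> on \<open>\<nu>\<close> the objective is
  quadratic in \<open>t\<close> and largest at \<open>t = 0\<close>, so its derivative there is at
  most 0. The right-hand side is the integral of \<open>\<psi> - emb \<mu>\<close> against
  \<open>\<mu>\<close>.\<close>

lemma maximizer_variation:
  assumes \<mu>: "maximizer \<mu>" and \<nu>: "\<nu> \<in> D"
  shows "(\<integral>x. \<psi> x \<partial>\<nu>) - emb \<mu> \<bullet> emb \<nu> \<le> (\<integral>x. \<psi> x \<partial>\<mu>) - (norm (emb \<mu>))\<^sup>2"
proof -
  have \<mu>D: "\<mu> \<in> D" using \<mu> by (simp add: maximizer_def)
  define m n where "m = emb \<mu>" and "n = emb \<nu>"
  define a where "a = (\<integral>x. \<psi> x \<partial>\<nu>) - (\<integral>x. \<psi> x \<partial>\<mu>)"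
  have "a - (n - m) \<bullet> m \<le> 0"
  proof (rule tangent_nonpos)
    fix t :: real assume t: "0 \<le> t" "t \<le> 1"
    obtain \<kappa> where \<kappa>: "\<kappa> \<in> D" and int: "\<And>f :: 'a \<Rightarrow> real. continuous_on \<Omega> f \<Longrightarrow>
        (\<integral>x. f x \<partial>\<kappa>) = t * (\<integral>x. f x \<partial>\<nu>) + (1 - t) * (\<integral>x. f x \<partial>\<mu>)"
      by (rule distributions_mixture[OF \<nu> \<mu>D compact_K K_subset t]) blast
    have \<kappa>_eq: "emb \<kappa> = m + t *\<^sub>R (n - m)"
      by (rule emb_eqI)
        (simp add: int[OF cont_ev] integral_ev[OF \<nu>] integral_ev[OF \<mu>D] m_def n_def
          algebra_simps)
    have "obj \<kappa> \<le> obj \<mu>" using \<mu> \<kappa> by (simp add: maximizer_def)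
    moreover have "t * (\<integral>x. \<psi> x \<partial>\<nu>) + (1 - t) * (\<integral>x. \<psi> x \<partial>\<mu>) = t * a + (\<integral>x. \<psi> x \<partial>\<mu>)"
      by (simp add: a_def algebra_simps)
    ultimately have "t * a + (norm m)\<^sup>2 / 2 \<le> (norm (m + t *\<^sub>R (n - m)))\<^sup>2 / 2"
      unfolding objective_def int[OF cont_psi] \<kappa>_eq m_def[symmetric] by linarith
    also have "(norm (m + t *\<^sub>R (n - m)))\<^sup>2 = (norm m)\<^sup>2 + 2 * t * ((n - m) \<bullet> m) + t\<^sup>2 * (norm (n - m))\<^sup>2"
      unfolding power2_norm_eq_inner
      by (simp add: inner_commute power2_eq_square[of t] algebra_simps)
    finally show "t * (a - (n - m) \<bullet> m) \<le> t\<^sup>2 * ((norm (n - m))\<^sup>2 / 2)"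
      by (simp add: algebra_simps)
  qed
  then show ?thesis unfolding a_def m_def n_def
    by (simp add: inner_diff inner_commute power2_norm_eq_inner)
qed

text \<open>The case of a Dirac measure at \<open>x\<close> in \<open>maximizer_variation\<close>:
  the aesthetic margin of a maximiser is nowhere positive on \<open>K\<close>.\<close>

lemma maximizer_pointwise:
  assumes "maximizer \<mu>" "x \<in> K"
  shows "\<psi> x - ev (emb \<mu>) x \<le> (\<integral>x. \<psi> x \<partial>\<mu>) - (norm (emb \<mu>))\<^sup>2"
  using maximizer_variation[OF assms(1) D_return[OF assms(2)]] integral_ev[OF D_return[OF assms(2)], of "emb \<mu>"]
  by (simp add: integral_dirac assms cont_psi cont_ev)

text \<open>The objective differs from its linearisation at \<open>\<mu>\<close> by exactly minus
  half the squared distance of the embeddings. This strong concavity serves both sufficiency of the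
  first-order condition and uniqueness of the embedding.\<close>

lemma obj_gap:
  assumes "\<nu> \<in> D" "(\<integral>x. \<psi> x \<partial>\<nu>) - emb \<mu> \<bullet> emb \<nu> \<le> (\<integral>x. \<psi> x \<partial>\<mu>) - (norm (emb \<mu>))\<^sup>2"
  shows "obj \<nu> \<le> obj \<mu> - (norm (emb \<nu> - emb \<mu>))\<^sup>2 / 2"
  using assms(2) unfolding objective_def
  by (simp add: power2_norm_eq_inner inner_diff inner_commute field_simps)

text \<open>Converse of \<open>maximizer_pointwise\<close>: integrating the pointwise bound against
  a competitor \<open>\<nu>\<close> gives the hypothesis of \<open>obj_gap\<close>.\<close>

lemma maximizerI:
  assumes \<mu>: "\<mu> \<in> D"
    and le: "\<And>x. x \<in> K \<Longrightarrow> \<psi> x - ev (emb \<mu>) x \<le> (\<integral>x. \<psi> x \<partial>\<mu>) - (norm (emb \<mu>))\<^sup>2"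
  shows "maximizer \<mu>"
  unfolding maximizer_def
proof (intro conjI ballI \<mu>)
  fix \<nu> assume \<nu>: "\<nu> \<in> D"
  have "(\<integral>x. \<psi> x - ev (emb \<mu>) x \<partial>\<nu>) \<le> (\<integral>x. (\<integral>x. \<psi> x \<partial>\<mu>) - (norm (emb \<mu>))\<^sup>2 \<partial>\<nu>)"
    by (intro integral_D_mono \<nu> continuous_intros cont_psi cont_ev le)
  then have "(\<integral>x. \<psi> x \<partial>\<nu>) - emb \<mu> \<bullet> emb \<nu> \<le> (\<integral>x. \<psi> x \<partial>\<mu>) - (norm (emb \<mu>))\<^sup>2"
    unfolding integral_const_D[OF \<nu>] integral_ev[OF \<nu>, symmetric]
    using integrable_D[OF \<nu> cont_psi] integrable_D[OF \<nu> cont_ev]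
    by (simp add: Bochner_Integration.integral_diff)
  from obj_gap[OF \<nu> this] show "obj \<nu> \<le> obj \<mu>"
    by (smt (verit) divide_nonneg_nonneg zero_le_power2)
qed

text \<open>Two maximisers have equal objective, so the quadratic gap in \<open>obj_gap\<close>
  makes their embeddings coincide and the \<open>THE\<close> in \<open>topiary\<close> is well
  defined.\<close>

lemma topiary_eq:
  assumes \<mu>: "maximizer \<mu>"
  shows "topiary \<Omega> ev \<psi> K = emb \<mu>"
  unfolding topiary_def
proof (rule the_equality)
  show "\<exists>\<mu>'\<in>D. (\<forall>\<nu>\<in>D. obj \<nu> \<le> obj \<mu>') \<and> emb \<mu>' = emb \<mu>"
    using \<mu> unfolding maximizer_def by blast
  fix m assume "\<exists>\<mu>'\<in>D. (\<forall>\<nu>\<in>D. obj \<nu> \<le> obj \<mu>') \<and> emb \<mu>' = m"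
  then obtain \<nu> where \<nu>: "\<nu> \<in> D" "obj \<mu> \<le> obj \<nu>" "emb \<nu> = m"
    using \<mu> unfolding maximizer_def by blast
  have "obj \<nu> \<le> obj \<mu> - (norm (emb \<nu> - emb \<mu>))\<^sup>2 / 2"
    using \<nu>(1) maximizer_variation[OF \<mu> \<nu>(1)] by (rule obj_gap)
  then have "(norm (emb \<nu> - emb \<mu>))\<^sup>2 \<le> 0" using \<nu>(2) by linarith
  then show "m = emb \<mu>" using \<nu>(3) by simp
qed

lemma compact_rkhs_subset:
  assumes "compact L" "L \<subseteq> K" "L \<noteq> {}"
  shows "compact_rkhs \<Omega> ev \<psi> L"
  using assms rkhs cont_ev cont_psi K_subset by unfold_locales auto

section \<open>Dense open sets of embedded measures and their maximum points\<close>

abbreviation E where "E \<equiv> embedded_measures \<Omega> ev K"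
abbreviation M where "M \<equiv> margin_maximizers ev \<psi> K"

definition dense_opens :: "'h set set" where
  "dense_opens = {U. openin (top_of_set E) U \<and> E \<subseteq> closure U}"

lemma green_frontier_eq: "green_frontier \<Omega> ev \<psi> K = (\<Inter>U\<in>dense_opens. closure (M U))"
  by (simp add: green_frontier_def dense_opens_def)

lemma emb_in_E: "\<mu> \<in> D \<Longrightarrow> emb \<mu> \<in> E"
proof -
  \<comment> \<open>\<open>closure_of\<close> only contains the part of a set inside the topspace,
    so the weak topology must be seen to cover the whole type; \<open>h = 0\<close> with
    \<open>W = UNIV\<close> does it.\<close>
  have "UNIV \<in> {{x :: 'h. x \<bullet> h \<in> W} | h W. open W}"
    by (rule CollectI, intro exI[of _ 0] exI[of _ UNIV]) simp
  then have "topspace weak_topology = (UNIV :: 'h set)"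
    unfolding weak_topology_def topology_generated_by_topspace by blast
  then show "\<mu> \<in> D \<Longrightarrow> emb \<mu> \<in> E"
    unfolding embedded_measures_def using closure_of_subset[of "emb ` D" weak_topology] by auto
qed

lemma M_mono: "U \<subseteq> V \<Longrightarrow> M U \<subseteq> M V"
  by (auto simp: margin_maximizers_def)

lemma closure_M_subset: "closure (M U) \<subseteq> K"
  by (rule closure_minimal) (auto simp: margin_maximizers_def closed_K)

text \<open>By compactness the supremum in \<open>margin_maximizers\<close> is a maximum, so every
  element of \<open>U\<close> contributes a point to \<open>M U\<close>.\<close>

lemma margin_attained:
  assumes "m \<in> U"
  obtains y where "y \<in> M U" "\<And>x. x \<in> K \<Longrightarrow> \<psi> x - ev m x \<le> \<psi> y - ev m y"
proof -
  have "continuous_on K (\<lambda>x. \<psi> x - ev m x)"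
    using cont_psi cont_ev K_subset by (intro continuous_intros) (auto intro: continuous_on_subset)
  then obtain y where y: "y \<in> K" "\<And>x. x \<in> K \<Longrightarrow> \<psi> x - ev m x \<le> \<psi> y - ev m y"
    using continuous_attains_sup[OF compact_K K_nonempty] by blast
  have "(SUP x\<in>K. \<psi> x - ev m x) = \<psi> y - ev m y"
    by (rule cSup_eq_maximum) (use y in auto)
  then have "y \<in> M U" using y(1) assms by (force simp: margin_maximizers_def)
  then show ?thesis using y that by blast
qed

text \<open>Density survives because \<open>V\<close> is open in \<open>E\<close>: points of
  \<open>V\<close> are limits of elements of \<open>U\<close>, and such elements close enough lie in
  \<open>V\<close>. Hence the sets \<open>closure (M U)\<close> are directed downwards.\<close>

lemma dense_opens_Int:
  assumes "U \<in> dense_opens" "V \<in> dense_opens"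
  shows "U \<inter> V \<in> dense_opens"
proof -
  have U: "openin (top_of_set E) U" "E \<subseteq> closure U" and V: "openin (top_of_set E) V" "E \<subseteq> closure V"
    using assms by (auto simp: dense_opens_def)
  obtain S where S: "open S" "V = E \<inter> S" using V(1) by (auto simp: openin_open)
  have UE: "U \<subseteq> E" using openin_imp_subset[OF U(1)] .
  have "V \<subseteq> closure (U \<inter> V)"
  proof -
    have "V \<subseteq> S \<inter> closure U" using S U by blast
    also have "\<dots> \<subseteq> closure (S \<inter> U)" by (rule open_Int_closure_subset[OF S(1)])
    also have "S \<inter> U = U \<inter> V" using S UE by blast
    finally show ?thesis .
  qed
  then have "E \<subseteq> closure (U \<inter> V)" using V(2) by (meson closed_closure closure_minimal order_trans)
  then show ?thesis using U V by (auto simp: dense_opens_def openin_Int)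
qed

text \<open>A maximiser on the smaller set \<open>L\<close> meets the first-order condition on
  \<open>L\<close>; density of \<open>U\<close> extends the condition to \<open>K\<close>, where it
  suffices for maximality.\<close>

lemma topiary_on_closure_M:
  assumes U: "U \<in> dense_opens"
  shows "\<exists>\<mu>\<in>distributions \<Omega> (closure (M U)). emb \<mu> = topiary \<Omega> ev \<psi> K"
proof -
  define L where "L = closure (M U)"
  have dense: "E \<subseteq> closure U" using U by (simp add: dense_opens_def)
  have "E \<noteq> {}" using emb_in_E D_return K_nonempty by blast
  then obtain u where "u \<in> U" using dense by (metis closure_empty subset_empty equals0I)
  then obtain y where "y \<in> M U" by (rule margin_attained)
  then have "L \<noteq> {}" using closure_subset unfolding L_def by blast
  moreover have LK: "L \<subseteq> K" unfolding L_def by (rule closure_M_subset)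
  moreover have "compact L"
    using compact_Int_closed[OF compact_K, of L] LK by (simp add: L_def Int_absorb1)
  ultimately interpret L: compact_rkhs \<Omega> ev \<psi> L by (intro compact_rkhs_subset)
  obtain \<mu> where \<mu>: "L.maximizer \<mu>" using L.maximizer_exists by blast
  then have \<mu>L: "\<mu> \<in> distributions \<Omega> L" by (simp add: L.maximizer_def)
  then have \<mu>D: "\<mu> \<in> D" using LK closed_K K_subset by (rule distributions_mono)
  define m c where "m = emb \<mu>" and "c = (\<integral>x. \<psi> x \<partial>\<mu>) - (norm (emb \<mu>))\<^sup>2"
  obtain B where B: "0 < B" "\<And>f x. x \<in> K \<Longrightarrow> \<bar>ev f x\<bar> \<le> B * norm f" by (rule ev_bound) blast
  have "\<psi> x - ev m x \<le> c" if x: "x \<in> K" for x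
  proof (rule ccontr)
    assume neg: "\<not> \<psi> x - ev m x \<le> c"
    \<comment> \<open>With this \<open>e\<close>, replacing \<open>m\<close> by \<open>m'\<close>
      shifts each value on \<open>K\<close> by less than \<open>B * e\<close>, half of the excess at
      \<open>x\<close>. So \<open>\<psi> - ev m'\<close> is above \<open>c + B * e\<close> at
      \<open>x\<close> and below it on \<open>L\<close>, yet it has a maximum point \<open>y\<close>
      in \<open>L\<close>.\<close>
    define e where "e = (\<psi> x - ev m x - c) / (2 * B)"
    have e: "0 < e" "2 * (B * e) = \<psi> x - ev m x - c"
      using neg B(1) by (auto simp: e_def)
    have "m \<in> closure U" using emb_in_E[OF \<mu>D] dense by (auto simp: m_def)
    then obtain m' where m': "m' \<in> U" "norm (m' - m) < e"
      using e(1) by (auto simp: closure_approachable dist_norm)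
    obtain y where y: "y \<in> M U" and max: "\<And>x. x \<in> K \<Longrightarrow> \<psi> x - ev m' x \<le> \<psi> y - ev m' y"
      using m'(1) by (rule margin_attained) blast
    have yL: "y \<in> L" using y closure_subset unfolding L_def by blast
    have near: "\<bar>ev m' z - ev m z\<bar> < B * e" if "z \<in> K" for z
    proof -
      have "\<bar>ev (m' - m) z\<bar> \<le> B * norm (m' - m)" using that by (rule B(2))
      also have "\<dots> < B * e" using m'(2) B(1) by simp
      finally show ?thesis using that K_subset by (simp add: ev_linear subset_iff)
    qed
    have "\<psi> y - ev m y \<le> c" using L.maximizer_pointwise[OF \<mu> yL] by (simp add: m_def c_def)
    then show False using max[OF x] near[OF x] near[of y] yL LK e(2) by auto
  qed
  then have "maximizer \<mu>" using \<mu>D by (intro maximizerI) (auto simp: m_def c_def)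
  then show ?thesis using topiary_eq \<mu>L unfolding L_def by metis
qed

lemma topiary_on_green_frontier:
  "\<exists>\<mu>\<in>distributions \<Omega> (green_frontier \<Omega> ev \<psi> K). emb \<mu> = topiary \<Omega> ev \<psi> K"
proof -
  define \<tau> where "\<tau> = topiary \<Omega> ev \<psi> K"
  define S where "S U = {\<nu> \<in> distributions \<Omega> (closure (M U)). emb \<nu> = \<tau>}" for U
  \<comment> \<open>The sets \<open>S U\<close> are nonempty and directed, so they generate a proper
    filter. Along it the embedding is constantly \<open>\<tau>\<close>, while the mass sits on ever
    smaller sets \<open>closure (M U)\<close>.\<close>
  define F where "F = (INF U\<in>dense_opens. principal (S U))"
  have E_in: "E \<in> dense_opens" by (simp add: dense_opens_def closure_subset)
  have clsub: "closed (closure (M U))" "closure (M U) \<subseteq> \<Omega>" for U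
    using closure_M_subset K_subset by blast+
  have S_mono: "S U \<subseteq> S V" if "U \<subseteq> V" for U V
    using distributions_mono[OF _ closure_mono[OF M_mono[OF that]] clsub] by (auto simp: S_def)
  have evF: "eventually P F \<longleftrightarrow> (\<exists>U\<in>dense_opens. \<forall>\<nu>\<in>S U. P \<nu>)" for P
  proof -
    have "\<exists>W\<in>dense_opens. principal (S W) \<le> inf (principal (S U)) (principal (S V))"
      if "U \<in> dense_opens" "V \<in> dense_opens" for U V
      using dense_opens_Int[OF that] S_mono by (intro bexI[of _ "U \<inter> V"]) auto
    then have "eventually P F \<longleftrightarrow> (\<exists>U\<in>dense_opens. eventually P (principal (S U)))"
      unfolding F_def using E_in by (intro eventually_INF_base) auto
    then show ?thesis by (simp add: eventually_principal)
  qed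
  have "S U \<noteq> {}" if "U \<in> dense_opens" for U
    using topiary_on_closure_M[OF that] by (auto simp: S_def \<tau>_def)
  then have F: "F \<noteq> bot" unfolding trivial_limit_def evF by blast
  have S_D: "S U \<subseteq> D" for U
    using distributions_mono[OF _ closure_M_subset closed_K K_subset] by (auto simp: S_def)
  have "eventually (\<lambda>\<nu>. \<nu> \<in> D) F" unfolding evF using E_in S_D by blast
  then obtain G \<mu> where G: "G \<le> F" "G \<noteq> bot" and \<mu>: "\<mu> \<in> D"
    and lim: "\<And>f :: 'a \<Rightarrow> real. continuous_on \<Omega> f \<Longrightarrow> ((\<lambda>\<nu>. \<integral>x. f x \<partial>\<nu>) \<longlongrightarrow> (\<integral>x. f x \<partial>\<mu>)) G"
    and supp: "\<And>S. \<lbrakk>closed S; S \<subseteq> K; \<And>C. compact C \<Longrightarrow> C \<subseteq> K - S \<Longrightarrow>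
       eventually (\<lambda>\<nu>. measure \<nu> C = 0) F\<rbrakk> \<Longrightarrow> \<mu> \<in> distributions \<Omega> S"
    by (rule distributions_cluster[OF compact_K K_subset F]) blast
  \<comment> \<open>The integrals of each \<open>ev f\<close> converge along \<open>G\<close>, and
    eventually they all equal \<open>f \<bullet> \<tau>\<close>.\<close>
  have "emb \<mu> = \<tau>"
  proof (rule emb_eqI, rule tendsto_unique[OF G(2) lim[OF cont_ev]])
    fix f
    have "eventually (\<lambda>\<nu>. (\<integral>x. ev f x \<partial>\<nu>) = f \<bullet> \<tau>) F"
      unfolding evF using E_in S_D integral_ev by (force simp: S_def)
    then show "((\<lambda>\<nu>. \<integral>x. ev f x \<partial>\<nu>) \<longlongrightarrow> f \<bullet> \<tau>) G"
      using G(1) by (intro tendsto_eventually) (rule filter_leD)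
  qed
  moreover have "\<mu> \<in> distributions \<Omega> (green_frontier \<Omega> ev \<psi> K)"
    unfolding green_frontier_eq
  proof (rule supp)
    show "closed (\<Inter>U\<in>dense_opens. closure (M U))" by auto
    show "(\<Inter>U\<in>dense_opens. closure (M U)) \<subseteq> K" using E_in closure_M_subset by blast
    fix C assume C: "compact C" "C \<subseteq> K - (\<Inter>U\<in>dense_opens. closure (M U))"
    \<comment> \<open>If \<open>C\<close> met every \<open>closure (M U)\<close>, it would meet
      finite intersections too, as finitely many \<open>U\<close> contain a common dense open
      \<open>V\<close>; by compactness some point of \<open>C\<close> would then lie on the green
      frontier.\<close>
    have "\<exists>U\<in>dense_opens. C \<inter> closure (M U) = {}"
    proof (rule ccontr)
      assume *: "\<not> ?thesis"
      have "C \<inter> (\<Inter>U\<in>dense_opens. closure (M U)) \<noteq> {}"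
      proof (rule compact_imp_fip_image[OF C(1)])
        fix I assume I: "finite I" "I \<subseteq> dense_opens"
        have "\<exists>V\<in>dense_opens. \<forall>U\<in>I. V \<subseteq> U"
          using I
        proof (induction I)
          case (insert U I)
          then obtain V where "V \<in> dense_opens" "\<forall>U\<in>I. V \<subseteq> U" by auto
          then show ?case using insert.prems by (intro bexI[of _ "U \<inter> V"]) (auto intro: dense_opens_Int)
        qed (use E_in in auto)
        then obtain V where V: "V \<in> dense_opens" "\<forall>U\<in>I. V \<subseteq> U" by blast
        then have "closure (M V) \<subseteq> (\<Inter>U\<in>I. closure (M U))" by (meson INT_greatest M_mono closure_mono)
        then show "C \<inter> (\<Inter>U\<in>I. closure (M U)) \<noteq> {}" using * V(1) by blast
      qed simp
      then show False using C(2) by blast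
    qed
    then obtain U where U: "U \<in> dense_opens" "C \<inter> closure (M U) = {}" by blast
    have "measure \<nu> C = 0" if "\<nu> \<in> S U" for \<nu>
    proof -
      have \<nu>: "\<nu> \<in> distributions \<Omega> (closure (M U))" using that by (simp add: S_def)
      have "AE x in \<nu>. x \<notin> C" using distributions_AE[OF \<nu>] U(2) by auto
      moreover have "C \<in> sets \<nu>"
        using C K_subset by (intro distributions_closed_sets[OF \<nu>] compact_imp_closed) auto
      ultimately have "emeasure \<nu> C = 0" by (simp add: AE_iff_null_sets null_setsD1)
      then show ?thesis by (simp add: measure_def)
    qed
    then show "eventually (\<lambda>\<nu>. measure \<nu> C = 0) F" unfolding evF using U(1) by blast
  qed
  ultimately show ?thesis unfolding \<tau>_def by blast
qed

end

text \<open>Continuity of each \<open>ev f\<close> makes it integrable against distributions on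
  \<open>K\<close>, so that embeddings exist; \<open>K\<close> is taken nonempty because the empty
  set carries no probability measure. Support on the green frontier is expressed by measure
  1.\<close>

theorem theorem6p2:
  fixes \<Omega> :: "'a::t2_space set"
    and ev :: "'h::{real_inner,complete_space} \<Rightarrow> 'a \<Rightarrow> real"
    and \<psi> :: "'a \<Rightarrow> real"
    and K :: "'a set"
  assumes "rkhs \<Omega> ev"
    and "\<And>f. continuous_on \<Omega> (ev f)"
    and "continuous_on \<Omega> \<psi>"
    and "compact K" and "K \<subseteq> \<Omega>" and "K \<noteq> {}"
  shows "\<exists>\<mu>\<in>distributions \<Omega> (green_frontier \<Omega> ev \<psi> K).
           kernel_embedding ev \<mu> = topiary \<Omega> ev \<psi> K"
proof -
  interpret compact_rkhs \<Omega> ev \<psi> K using assms by unfold_locales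
  show ?thesis by (rule topiary_on_green_frontier)
qed

end
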